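(* Nonabelian T-duality is Morita invariant: Let $N$ be a closed normal subgroup of a locally compact group $G$. For $i=1,2$ let $\mathcal G^{(i)}$ be a groupoid, $\bar\rho_i:\mathcal G^{(i)}\to G/N$ a homomorphism with a continuous lift $\rho_i:\mathcal G^{(i)}\to G$, let $\mathcal L_i:=G\rtimes N\rtimes^{\delta\rho_i}\mathcal G^{(i)}$, and let $(\sigma_i,\lambda_i,\beta_i)\in Z^2_G(\mathcal L_i;U(1))$, with image $\psi_i\in Z^2(G\ltimes\mathcal L_i;U(1))$. Suppose that the two sets of data represent the same generalized principal bundle with $G$-equivariant gerbe, i.e. there is a $G$-equivariant Morita equivalence $(\mathcal L_1$-$\mathcal L_2)$-bimodule $R$ such that $\psi_1$ and $\psi_2$ are cohomologous along the induced Morita $(G\ltimes\mathcal L_1)$-$(G\ltimes\mathcal L_2)$-bimodule $G\times R$. Then the nonabelian T-duals $(N\rtimes^{\delta\rho_1}\mathcal G^{(1)},\iota_1^*\psi_1)$ and $(N\rtimes^{\delta\rho_2}\mathcal G^{(2)},\iota_2^*\psi_2)$ are Morita equivalent, i.e. the $U(1)$-gerbes $$U(1)\rtimes^{\iota_1^*\psi_1}(N\rtimes^{\delta\rho_1}\mathcal G^{(1)})\quad\text{and}\quad U(1)\rtimes^{\iota_2^*\psi_2}(N\rtimes^{\delta\rho_2}\mathcal G^{(2)})$$ are Morita equivalent.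
   Context: A groupoid $\mathcal G=(\mathcal G_1\rightrightarrows\mathcal G_0)$ is a topological groupoid with source $s$ and range $r$ (the product $\gamma_1\gamma_2$ is defined when $s\gamma_1=r\gamma_2$), whose arrow space is locally compact Hausdorff and second countable, equipped with a left Haar system. With $\delta\rho(\gamma_1,\gamma_2)=\rho(\gamma_1)\rho(\gamma_2)\rho(\gamma_1\gamma_2)^{-1}\in N$, $N\rtimes^{\delta\rho}\mathcal G=(N\times\mathcal G_1\rightrightarrows\mathcal G_0)$ has product $(n_1,\gamma_1)(n_2,\gamma_2)=(n_1\rho(\gamma_1)n_2\rho(\gamma_1)^{-1}\delta\rho(\gamma_1,\gamma_2),\gamma_1\gamma_2)$. $G\rtimes N\rtimes^{\delta\rho}\mathcal G=(G\times N\times\mathcal G_1\rightrightarrows G\times\mathcal G_0)$ has $r(g,n,\gamma)=(g,r\gamma)$, $s(g,n,\gamma)=(gn\rho(\gamma),s\gamma)$, composition that of $N\rtimes^{\delta\rho}\mathcal G$ in the last two variables, and left $G$-translation in the first variable; it presents a principal $G/N$-bundle (it is $G$-equivariantly Morita equivalent to the generalized bundle $G/N\rtimes_{\bar\rho}\mathcal G$). For a $G$-groupoid $\mathcal L$, $G\ltimes\mathcal L$ has arrows $G\times\mathcal L_1$, objects $\mathcal L_0$, $s(g,\gamma)=s(g^{-1}\gamma)$, $r(g,\gamma)=r\gamma$, $(g,\gamma)(g',g^{-1}\gamma')=(gg',\gamma\gamma')$. $Z^2_G(\mathcal L;U(1))$ consists of triples of continuous $U(1)$-valued functions $\sigma$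 on $\mathcal L_2$, $\lambda$ on $G\times\mathcal L_1$, $\beta$ on $G\times G\times\mathcal L_0$ with $\delta\sigma=1$, $d\sigma=\delta\lambda$, $\delta\beta\,d\lambda=1$, $d\beta=1$, where $\delta$ is the groupoid cochain differential of $\mathcal L$ and $d$ the group cochain differential of $G$ for the action $(g\cdot f)(h_1,\dots)=f(g^{-1}h_1,\dots)$. Its image in $Z^2(G\ltimes\mathcal L;U(1))$ is $\psi((g_1,h_1),(g_2,g_1^{-1}h_2))=\sigma(h_1,h_2)\lambda(g_1,h_2)\beta(g_1,g_2,sh_2)$. Nonabelian T-dualization sends the initial data $(\mathcal L=G\rtimes N\rtimes^{\delta\rho}\mathcal G,(\sigma,\lambda,\beta))$ first to $(G\ltimes\mathcal L,\psi)$ and then to $(N\rtimes^{\delta\rho}\mathcal G,\iota^*\psi)$, where $\iota:N\rtimes^{\delta\rho}\mathcal G\hookrightarrow G\ltimes\mathcal L$, $\iota(n,\gamma)=(n\rho(\gamma),e,n,\gamma)$. A Morita equivalence $(\mathcal H$-$\mathcal K)$-bimodule is a space $P$ with commuting free and proper left $\mathcal H$- and right $\mathcal K$-actions whose moment maps induce homeomorphisms $P/\mathcal K\cong\mathcal H_0$, $\mathcal H\backslash P\cong\mathcal K_0$; for $G$-groupoids it is $G$-equivariant if $G$ acts with $g(hpk)=g(h)g(p)g(k)$, and then $G\times P$ is a Morita $(G\ltimes\mathcal H)$-$(G\ltimes\mathcal K)$-bimodule via $(g,h)(g',p)=(gg',h\,gp)$, $(g',p)(g'',k)=(g'g'',p\,g'k)$.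 Cocycles $\psi\in Z^2(\mathcal H;U(1))$, $\chi\in Z^2(\mathcal K;U(1))$ are cohomologous along $P$ if there are continuous $U(1)$-valued $\mu(h,p)$ and $\nu(p,k)$ with $\mu(h_2,p)\mu(h_1h_2,p)^{-1}\mu(h_1,h_2p)=\psi(h_1,h_2)$, $\nu(pk_1,k_2)\nu(p,k_1k_2)^{-1}\nu(p,k_1)=\chi(k_1,k_2)$, $\mu(h,p)\nu(hp,k)=\nu(p,k)\mu(h,pk)$. $U(1)\rtimes^\psi\mathcal H$ is $(U(1)\times\mathcal H_1\rightrightarrows\mathcal H_0)$ with product $(\theta_1,h_1)(\theta_2,h_2)=(\theta_1\theta_2\psi(h_1,h_2),h_1h_2)$. *)

theory Defs
  imports "HOL-Analysis.Analysis" "HOL-Algebra.Coset"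
begin

section \<open>Quotient spaces\<close>

text \<open>The quotient topology on a partition \<open>C\<close> of the underlying set of \<open>X\<close>; the points are the
  blocks of \<open>C\<close>.\<close>

definition quotient_space :: "'a topology \<Rightarrow> 'a set set \<Rightarrow> 'a set topology"
  where "quotient_space X C = topology (\<lambda>U. U \<subseteq> C \<and> openin X (\<Union>U))"

lemma openin_quotient_space:
  assumes "disjoint C"
  shows "openin (quotient_space X C) U \<longleftrightarrow> U \<subseteq> C \<and> openin X (\<Union>U)"
proof -
  have "istopology (\<lambda>U. U \<subseteq> C \<and> openin X (\<Union>U))"
    unfolding istopology_def
  proof (intro conjI allI impI; (elim conjE)?)
    fix S T assume S: "S \<subseteq> C" "openin X (\<Union>S)" and T: "T \<subseteq> C" "openin X (\<Union>T)"
    have "\<Union>(S \<inter> T) = \<Union>S \<inter> \<Union>T"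
    proof
      show "\<Union>S \<inter> \<Union>T \<subseteq> \<Union>(S \<inter> T)"
      proof
        fix x assume "x \<in> \<Union>S \<inter> \<Union>T"
        then obtain A B where AB: "A \<in> S" "B \<in> T" "x \<in> A" "x \<in> B" by blast
        then have "A = B"
          using disjointD[OF assms, of A B] S(1) T(1) by blast
        then show "x \<in> \<Union>(S \<inter> T)" using AB by blast
      qed
    qed blast
    then show "openin X (\<Union>(S \<inter> T))" using S T by (simp add: openin_Int)
    show "S \<inter> T \<subseteq> C" using S by blast
  next
    fix K assume K: "\<forall>S\<in>K. S \<subseteq> C \<and> openin X (\<Union>S)"
    show "\<Union>K \<subseteq> C" using K by blast
    have "\<Union>(\<Union>K) = \<Union>(Union ` K)" by blast
    then show "openin X (\<Union>(\<Union>K))" using K by (metis (no_types, lifting) image_iff openin_Union)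
  qed
  then show ?thesis by (simp add: quotient_space_def)
qed


section \<open>Topological groupoids\<close>

record ('a, 'o) groupoid =
  arrow_space :: "'a topology"
  object_space :: "'o topology"
  src :: "'a \<Rightarrow> 'o"
  rng :: "'a \<Rightarrow> 'o"
  arrow_comp :: "'a \<Rightarrow> 'a \<Rightarrow> 'a"
  ident :: "'o \<Rightarrow> 'a"
  inverse_arrow :: "'a \<Rightarrow> 'a"

abbreviation arrows :: "('a, 'o, 'z) groupoid_scheme \<Rightarrow> 'a set"
  where "arrows H \<equiv> topspace (arrow_space H)"

abbreviation objects :: "('a, 'o, 'z) groupoid_scheme \<Rightarrow> 'o set"
  where "objects H \<equiv> topspace (object_space H)"

text \<open>A product \<open>x y\<close> is defined when the source of \<open>x\<close> is the range of \<open>y\<close>. The functions of the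
  record are unconstrained away from their domains.\<close>

definition composable_pairs :: "('a, 'o, 'z) groupoid_scheme \<Rightarrow> ('a \<times> 'a) set"
  where "composable_pairs H = {(x, y). x \<in> arrows H \<and> y \<in> arrows H \<and> src H x = rng H y}"

definition composable_space :: "('a, 'o, 'z) groupoid_scheme \<Rightarrow> ('a \<times> 'a) topology"
  where "composable_space H =
    subtopology (prod_topology (arrow_space H) (arrow_space H)) (composable_pairs H)"

locale topological_groupoid =
  fixes H :: "('a, 'o, 'z) groupoid_scheme"
  assumes continuous_src: "continuous_map (arrow_space H) (object_space H) (src H)"
    and continuous_rng: "continuous_map (arrow_space H) (object_space H) (rng H)"
    and continuous_comp:
      "continuous_map (composable_space H) (arrow_space H) (\<lambda>(x, y). arrow_comp H x y)"
    and continuous_ident: "continuous_map (object_space H) (arrow_space H) (ident H)"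
    and continuous_inverse: "continuous_map (arrow_space H) (arrow_space H) (inverse_arrow H)"
    and src_comp: "(x, y) \<in> composable_pairs H \<Longrightarrow> src H (arrow_comp H x y) = src H y"
    and rng_comp: "(x, y) \<in> composable_pairs H \<Longrightarrow> rng H (arrow_comp H x y) = rng H x"
    and comp_assoc: "\<lbrakk>(x, y) \<in> composable_pairs H; (y, z) \<in> composable_pairs H\<rbrakk>
      \<Longrightarrow> arrow_comp H (arrow_comp H x y) z = arrow_comp H x (arrow_comp H y z)"
    and src_ident: "u \<in> objects H \<Longrightarrow> src H (ident H u) = u"
    and rng_ident: "u \<in> objects H \<Longrightarrow> rng H (ident H u) = u"
    and ident_comp: "x \<in> arrows H \<Longrightarrow> arrow_comp H (ident H (rng H x)) x = x"
    and comp_ident: "x \<in> arrows H \<Longrightarrow> arrow_comp H x (ident H (src H x)) = x"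
    and src_inverse: "x \<in> arrows H \<Longrightarrow> src H (inverse_arrow H x) = rng H x"
    and rng_inverse: "x \<in> arrows H \<Longrightarrow> rng H (inverse_arrow H x) = src H x"
    and inverse_comp: "x \<in> arrows H \<Longrightarrow> arrow_comp H (inverse_arrow H x) x = ident H (src H x)"
    and comp_inverse: "x \<in> arrows H \<Longrightarrow> arrow_comp H x (inverse_arrow H x) = ident H (rng H x)"

definition compactly_supported :: "'a topology \<Rightarrow> ('a \<Rightarrow> complex) set"
  where "compactly_supported X =
    {f. continuous_map X euclidean f \<and> (\<exists>K. compactin X K \<and> (\<forall>x \<in> topspace X - K. f x = 0))}"

text \<open>A left Haar system: Radon measures \<open>m u\<close> on the arrow space, one for each object \<open>u\<close>, with
  support the range fibre over \<open>u\<close>, continuous in \<open>u\<close> and left invariant. On a second countable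
  locally compact Hausdorff space the Radon measures are the Borel measures that are finite on
  compact sets. In the invariance axiom the first integral is restricted to the range fibre, outside
  of which the product is meaningless.\<close>

locale left_haar_groupoid = topological_groupoid H
  for H :: "('a, 'o, 'z) groupoid_scheme" and m :: "'o \<Rightarrow> 'a measure" +
  assumes locally_compact: "locally_compact_space (arrow_space H)"
    and Hausdorff: "Hausdorff_space (arrow_space H)"
    and second_countable: "second_countable (arrow_space H)"
    and haar_sets:
      "u \<in> objects H \<Longrightarrow> sets (m u) = sigma_sets (arrows H) {U. openin (arrow_space H) U}"
    and haar_finite: "\<lbrakk>u \<in> objects H; compactin (arrow_space H) K\<rbrakk> \<Longrightarrow> emeasure (m u) K < \<infinity>"
    and haar_support: "\<lbrakk>u \<in> objects H; openin (arrow_space H) U\<rbrakk>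
      \<Longrightarrow> emeasure (m u) U = 0 \<longleftrightarrow> (\<forall>x\<in>U. rng H x \<noteq> u)"
    and haar_continuous: "f \<in> compactly_supported (arrow_space H)
      \<Longrightarrow> continuous_map (object_space H) euclidean (\<lambda>u. LINT x|m u. f x)"
    and haar_invariant: "\<lbrakk>x \<in> arrows H; f \<in> compactly_supported (arrow_space H)\<rbrakk>
      \<Longrightarrow> (LINT y:{y \<in> arrows H. rng H y = src H x}|m (src H x). f (arrow_comp H x y))
        = (LINT y|m (rng H x). f y)"


section \<open>Locally compact groups and their actions\<close>

locale locally_compact_group = group G
  for G :: "('g, 'm) monoid_scheme" (structure) and T :: "'g topology" +
  assumes topspace_eq: "topspace T = carrier G"
    and continuous_mult: "continuous_map (prod_topology T T) T (\<lambda>(g, h). g \<otimes> h)"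
    and continuous_inv: "continuous_map T T (\<lambda>g. inv g)"
    and Hausdorff: "Hausdorff_space T"
    and locally_compact: "locally_compact_space T"

locale continuous_group_action = locally_compact_group G T
  for G :: "('g, 'm) monoid_scheme" (structure) and T :: "'g topology"
    and X :: "'a topology" and act :: "'g \<Rightarrow> 'a \<Rightarrow> 'a" +
  assumes continuous_act: "continuous_map (prod_topology T X) X (\<lambda>(g, x). act g x)"
    and act_one: "x \<in> topspace X \<Longrightarrow> act \<one> x = x"
    and act_mult: "\<lbrakk>g \<in> carrier G; h \<in> carrier G; x \<in> topspace X\<rbrakk>
      \<Longrightarrow> act (g \<otimes> h) x = act g (act h x)"

record ('g, 'a, 'o) G_groupoid = "('a, 'o) groupoid" +
  arrow_act :: "'g \<Rightarrow> 'a \<Rightarrow> 'a"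
  object_act :: "'g \<Rightarrow> 'o \<Rightarrow> 'o"

locale equivariant_groupoid =
  topological_groupoid L +
  arrow_action: continuous_group_action G T "arrow_space L" "arrow_act L" +
  object_action: continuous_group_action G T "object_space L" "object_act L"
  for G :: "('g, 'm) monoid_scheme" and T :: "'g topology"
    and L :: "('g, 'a, 'o, 'z) G_groupoid_scheme" +
  assumes act_src: "\<lbrakk>g \<in> carrier G; x \<in> arrows L\<rbrakk>
      \<Longrightarrow> src L (arrow_act L g x) = object_act L g (src L x)"
    and act_rng: "\<lbrakk>g \<in> carrier G; x \<in> arrows L\<rbrakk>
      \<Longrightarrow> rng L (arrow_act L g x) = object_act L g (rng L x)"
    and act_comp: "\<lbrakk>g \<in> carrier G; (x, y) \<in> composable_pairs L\<rbrakk>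
      \<Longrightarrow> arrow_act L g (arrow_comp L x y) = arrow_comp L (arrow_act L g x) (arrow_act L g y)"

text \<open>The groupoid \<open>G \<ltimes> L\<close>. Substituting \<open>y = g\<inverse> y'\<close> in \<open>(g, x) (g', g\<inverse> y') = (g g', x y')\<close> gives
  the product below.\<close>

definition crossed_groupoid ::
  "('g, 'm) monoid_scheme \<Rightarrow> 'g topology \<Rightarrow> ('g, 'a, 'o, 'z) G_groupoid_scheme
    \<Rightarrow> ('g \<times> 'a, 'o) groupoid"
  where "crossed_groupoid G T L =
    \<lparr>arrow_space = prod_topology T (arrow_space L),
     object_space = object_space L,
     src = (\<lambda>(g, x). src L (arrow_act L (inv\<^bsub>G\<^esub> g) x)),
     rng = (\<lambda>(g, x). rng L x),
     arrow_comp = (\<lambda>(g, x) (g', y). (g \<otimes>\<^bsub>G\<^esub> g', arrow_comp L x (arrow_act L g y))),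
     ident = (\<lambda>u. (\<one>\<^bsub>G\<^esub>, ident L u)),
     inverse_arrow =
       (\<lambda>(g, x). (inv\<^bsub>G\<^esub> g, arrow_act L (inv\<^bsub>G\<^esub> g) (inverse_arrow L x)))\<rparr>"


section \<open>Homomorphisms to a quotient group and the associated groupoids\<close>

text \<open>The group \<open>G/N\<close> carries the quotient topology.\<close>

definition homomorphism_to_quotient ::
  "('g, 'm) monoid_scheme \<Rightarrow> 'g topology \<Rightarrow> 'g set \<Rightarrow> ('a, 'o, 'z) groupoid_scheme
    \<Rightarrow> ('a \<Rightarrow> 'g set) \<Rightarrow> bool"
  where "homomorphism_to_quotient G T N H \<rho>' \<longleftrightarrow>
    continuous_map (arrow_space H) (quotient_space T (carrier (G Mod N))) \<rho>' \<and>
    (\<forall>(x, y) \<in> composable_pairs H. \<rho>' (arrow_comp H x y) = \<rho>' x \<otimes>\<^bsub>G Mod N\<^esub> \<rho>' y)"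

definition continuous_lift ::
  "('g, 'm) monoid_scheme \<Rightarrow> 'g topology \<Rightarrow> 'g set \<Rightarrow> ('a, 'o, 'z) groupoid_scheme
    \<Rightarrow> ('a \<Rightarrow> 'g set) \<Rightarrow> ('a \<Rightarrow> 'g) \<Rightarrow> bool"
  where "continuous_lift G T N H \<rho>' \<rho> \<longleftrightarrow>
    continuous_map (arrow_space H) T \<rho> \<and> (\<forall>x \<in> arrows H. N #>\<^bsub>G\<^esub> \<rho> x = \<rho>' x)"

definition lift_defect ::
  "('g, 'm) monoid_scheme \<Rightarrow> ('a, 'o, 'z) groupoid_scheme \<Rightarrow> ('a \<Rightarrow> 'g) \<Rightarrow> 'a \<Rightarrow> 'a \<Rightarrow> 'g"
  where "lift_defect G H \<rho> x y = \<rho> x \<otimes>\<^bsub>G\<^esub> \<rho> y \<otimes>\<^bsub>G\<^esub> inv\<^bsub>G\<^esub> (\<rho> (arrow_comp H x y))"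

text \<open>The groupoid \<open>N \<rtimes> H\<close> twisted by the defect of \<open>\<rho>\<close>. As \<open>\<rho>\<close> need not preserve units, the
  \<open>N\<close>-component of a unit is \<open>\<rho>(1)\<inverse>\<close>; on \<open>n \<rho>(x)\<close> the product is multiplication in \<open>G\<close>, which
  determines the inverses.\<close>

definition twisted_groupoid ::
  "('g, 'm) monoid_scheme \<Rightarrow> 'g topology \<Rightarrow> 'g set \<Rightarrow> ('a, 'o, 'z) groupoid_scheme \<Rightarrow> ('a \<Rightarrow> 'g)
    \<Rightarrow> ('g \<times> 'a, 'o) groupoid"
  where "twisted_groupoid G T N H \<rho> =
    \<lparr>arrow_space = prod_topology (subtopology T N) (arrow_space H),
     object_space = object_space H,
     src = (\<lambda>(n, x). src H x),
     rng = (\<lambda>(n, x). rng H x),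
     arrow_comp = (\<lambda>(n, x) (n', y).
       (n \<otimes>\<^bsub>G\<^esub> \<rho> x \<otimes>\<^bsub>G\<^esub> n' \<otimes>\<^bsub>G\<^esub> inv\<^bsub>G\<^esub> (\<rho> x) \<otimes>\<^bsub>G\<^esub> lift_defect G H \<rho> x y,
        arrow_comp H x y)),
     ident = (\<lambda>u. (inv\<^bsub>G\<^esub> (\<rho> (ident H u)), ident H u)),
     inverse_arrow =
       (\<lambda>(n, x). (inv\<^bsub>G\<^esub> (n \<otimes>\<^bsub>G\<^esub> \<rho> x) \<otimes>\<^bsub>G\<^esub> inv\<^bsub>G\<^esub> (\<rho> (inverse_arrow H x)), inverse_arrow H x))\<rparr>"

text \<open>The \<open>G\<close>-groupoid \<open>G \<rtimes> N \<rtimes> H\<close>, which presents the principal \<open>G/N\<close>-bundle; \<open>G\<close> acts by left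
  translation of the first variable.\<close>

definition bundle_groupoid ::
  "('g, 'm) monoid_scheme \<Rightarrow> 'g topology \<Rightarrow> 'g set \<Rightarrow> ('a, 'o, 'z) groupoid_scheme \<Rightarrow> ('a \<Rightarrow> 'g)
    \<Rightarrow> ('g, 'g \<times> 'g \<times> 'a, 'g \<times> 'o) G_groupoid"
  where "bundle_groupoid G T N H \<rho> =
    \<lparr>arrow_space = prod_topology T (arrow_space (twisted_groupoid G T N H \<rho>)),
     object_space = prod_topology T (object_space H),
     src = (\<lambda>(g, n, x). (g \<otimes>\<^bsub>G\<^esub> n \<otimes>\<^bsub>G\<^esub> \<rho> x, src H x)),
     rng = (\<lambda>(g, n, x). (g, rng H x)),
     arrow_comp = (\<lambda>(g, a) (g', b). (g, arrow_comp (twisted_groupoid G T N H \<rho>) a b)),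
     ident = (\<lambda>(g, u). (g, ident (twisted_groupoid G T N H \<rho>) u)),
     inverse_arrow = (\<lambda>(g, n, x).
       (g \<otimes>\<^bsub>G\<^esub> n \<otimes>\<^bsub>G\<^esub> \<rho> x, inverse_arrow (twisted_groupoid G T N H \<rho>) (n, x))),
     arrow_act = (\<lambda>g (h, a). (g \<otimes>\<^bsub>G\<^esub> h, a)),
     object_act = (\<lambda>g (h, u). (g \<otimes>\<^bsub>G\<^esub> h, u))\<rparr>"


section \<open>Cocycles with values in the circle\<close>

abbreviation circle_space :: "complex topology"
  where "circle_space \<equiv> top_of_set (sphere 0 1)"

text \<open>Cochain differentials of a groupoid in degrees 0, 1 and 2.\<close>

definition delta0 :: "('a, 'o, 'z) groupoid_scheme \<Rightarrow> ('o \<Rightarrow> complex) \<Rightarrow> 'a \<Rightarrow> complex"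
  where "delta0 H f x = f (src H x) * inverse (f (rng H x))"

definition delta1 :: "('a, 'o, 'z) groupoid_scheme \<Rightarrow> ('a \<Rightarrow> complex) \<Rightarrow> 'a \<Rightarrow> 'a \<Rightarrow> complex"
  where "delta1 H f x y = f y * inverse (f (arrow_comp H x y)) * f x"

definition delta2 ::
  "('a, 'o, 'z) groupoid_scheme \<Rightarrow> ('a \<Rightarrow> 'a \<Rightarrow> complex) \<Rightarrow> 'a \<Rightarrow> 'a \<Rightarrow> 'a \<Rightarrow> complex"
  where "delta2 H f x y z =
    f y z * inverse (f (arrow_comp H x y) z) * f x (arrow_comp H y z) * inverse (f x y)"

text \<open>Group cochain differentials, in group degrees 0, 1 and 2, of cochains with values in functions
  on composable pairs, arrows and objects, respectively, on which \<open>g\<close> acts by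
  \<open>(g f)(x, \<dots>) = f (g\<inverse> x, \<dots>)\<close>.\<close>

definition d0 ::
  "('g, 'm) monoid_scheme \<Rightarrow> ('g, 'a, 'o, 'z) G_groupoid_scheme \<Rightarrow> ('a \<Rightarrow> 'a \<Rightarrow> complex)
    \<Rightarrow> 'g \<Rightarrow> 'a \<Rightarrow> 'a \<Rightarrow> complex"
  where "d0 G L f g x y =
    f (arrow_act L (inv\<^bsub>G\<^esub> g) x) (arrow_act L (inv\<^bsub>G\<^esub> g) y) * inverse (f x y)"

definition d1 ::
  "('g, 'm) monoid_scheme \<Rightarrow> ('g, 'a, 'o, 'z) G_groupoid_scheme \<Rightarrow> ('g \<Rightarrow> 'a \<Rightarrow> complex)
    \<Rightarrow> 'g \<Rightarrow> 'g \<Rightarrow> 'a \<Rightarrow> complex"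
  where "d1 G L f g h x =
    f h (arrow_act L (inv\<^bsub>G\<^esub> g) x) * inverse (f (g \<otimes>\<^bsub>G\<^esub> h) x) * f g x"

definition d2 ::
  "('g, 'm) monoid_scheme \<Rightarrow> ('g, 'a, 'o, 'z) G_groupoid_scheme \<Rightarrow> ('g \<Rightarrow> 'g \<Rightarrow> 'o \<Rightarrow> complex)
    \<Rightarrow> 'g \<Rightarrow> 'g \<Rightarrow> 'g \<Rightarrow> 'o \<Rightarrow> complex"
  where "d2 G L f g h k u =
    f h k (object_act L (inv\<^bsub>G\<^esub> g) u) * inverse (f (g \<otimes>\<^bsub>G\<^esub> h) k u) *
    f g (h \<otimes>\<^bsub>G\<^esub> k) u * inverse (f g h u)"

definition equivariant_2cocycle ::
  "('g, 'm) monoid_scheme \<Rightarrow> 'g topology \<Rightarrow> ('g, 'a, 'o, 'z) G_groupoid_scheme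
    \<Rightarrow> ('a \<Rightarrow> 'a \<Rightarrow> complex) \<Rightarrow> ('g \<Rightarrow> 'a \<Rightarrow> complex) \<Rightarrow> ('g \<Rightarrow> 'g \<Rightarrow> 'o \<Rightarrow> complex) \<Rightarrow> bool"
  where "equivariant_2cocycle G T L \<sigma> lam \<beta> \<longleftrightarrow>
    continuous_map (composable_space L) circle_space (\<lambda>(x, y). \<sigma> x y) \<and>
    continuous_map (prod_topology T (arrow_space L)) circle_space (\<lambda>(g, x). lam g x) \<and>
    continuous_map (prod_topology T (prod_topology T (object_space L))) circle_space
      (\<lambda>(g, h, u). \<beta> g h u) \<and>
    (\<forall>x y z. (x, y) \<in> composable_pairs L \<longrightarrow> (y, z) \<in> composable_pairs L \<longrightarrow>
      delta2 L \<sigma> x y z = 1) \<and>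
    (\<forall>g \<in> carrier G. \<forall>(x, y) \<in> composable_pairs L. d0 G L \<sigma> g x y = delta1 L (lam g) x y) \<and>
    (\<forall>g \<in> carrier G. \<forall>h \<in> carrier G. \<forall>x \<in> arrows L.
      delta0 L (\<beta> g h) x * d1 G L lam g h x = 1) \<and>
    (\<forall>g \<in> carrier G. \<forall>h \<in> carrier G. \<forall>k \<in> carrier G. \<forall>u \<in> objects L. d2 G L \<beta> g h k u = 1)"

text \<open>The image in the 2-cocycles of \<open>G \<ltimes> L\<close>, with \<open>y\<close> in the role of \<open>g\<inverse> h\<^sub>2\<close>.\<close>

definition crossed_cocycle ::
  "('g, 'a, 'o, 'z) G_groupoid_scheme
    \<Rightarrow> ('a \<Rightarrow> 'a \<Rightarrow> complex) \<Rightarrow> ('g \<Rightarrow> 'a \<Rightarrow> complex) \<Rightarrow> ('g \<Rightarrow> 'g \<Rightarrow> 'o \<Rightarrow> complex)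
    \<Rightarrow> 'g \<times> 'a \<Rightarrow> 'g \<times> 'a \<Rightarrow> complex"
  where "crossed_cocycle L \<sigma> lam \<beta> = (\<lambda>(g, x) (g', y).
    \<sigma> x (arrow_act L g y) * lam g (arrow_act L g y) * \<beta> g g' (src L (arrow_act L g y)))"

text \<open>The gerbe \<open>U(1) \<rtimes> H\<close> of a 2-cocycle \<open>\<psi>\<close>. As \<open>\<psi>\<close> need not be normalized, the circle component
  of the unit at \<open>u\<close> is \<open>\<psi>(1\<^sub>u, 1\<^sub>u)\<inverse>\<close>.\<close>

definition gerbe_groupoid ::
  "('a, 'o, 'z) groupoid_scheme \<Rightarrow> ('a \<Rightarrow> 'a \<Rightarrow> complex) \<Rightarrow> (complex \<times> 'a, 'o) groupoid"
  where "gerbe_groupoid H \<psi> =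
    \<lparr>arrow_space = prod_topology circle_space (arrow_space H),
     object_space = object_space H,
     src = (\<lambda>(t, x). src H x),
     rng = (\<lambda>(t, x). rng H x),
     arrow_comp = (\<lambda>(t, x) (t', y). (t * t' * \<psi> x y, arrow_comp H x y)),
     ident = (\<lambda>u. (inverse (\<psi> (ident H u) (ident H u)), ident H u)),
     inverse_arrow = (\<lambda>(t, x).
       (inverse (t * \<psi> x (inverse_arrow H x) * \<psi> (ident H (rng H x)) (ident H (rng H x))),
        inverse_arrow H x))\<rparr>"

text \<open>The inclusion \<open>\<iota>\<close> of \<open>N \<rtimes> H\<close> in \<open>G \<ltimes> (G \<rtimes> N \<rtimes> H)\<close>, and the cocycle of the T-dual.\<close>

definition dual_inclusion ::
  "('g, 'm) monoid_scheme \<Rightarrow> ('a \<Rightarrow> 'g) \<Rightarrow> 'g \<times> 'a \<Rightarrow> 'g \<times> 'g \<times> 'g \<times> 'a"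
  where "dual_inclusion G \<rho> = (\<lambda>(n, x). (n \<otimes>\<^bsub>G\<^esub> \<rho> x, \<one>\<^bsub>G\<^esub>, n, x))"

definition dual_cocycle ::
  "('g, 'm) monoid_scheme \<Rightarrow> ('a \<Rightarrow> 'g)
    \<Rightarrow> ('g \<times> 'g \<times> 'g \<times> 'a \<Rightarrow> 'g \<times> 'g \<times> 'g \<times> 'a \<Rightarrow> complex) \<Rightarrow> 'g \<times> 'a \<Rightarrow> 'g \<times> 'a \<Rightarrow> complex"
  where "dual_cocycle G \<rho> \<psi> = (\<lambda>a b. \<psi> (dual_inclusion G \<rho> a) (dual_inclusion G \<rho> b))"


section \<open>Morita equivalence\<close>

record ('p, 'h, 'k, 'u, 'v) bimodule =
  point_space :: "'p topology"
  left_moment :: "'p \<Rightarrow> 'u"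
  right_moment :: "'p \<Rightarrow> 'v"
  left_act :: "'h \<Rightarrow> 'p \<Rightarrow> 'p"
  right_act :: "'p \<Rightarrow> 'k \<Rightarrow> 'p"

abbreviation points :: "('p, 'h, 'k, 'u, 'v, 'z) bimodule_scheme \<Rightarrow> 'p set"
  where "points P \<equiv> topspace (point_space P)"

text \<open>The action \<open>h p\<close> is defined when the source of \<open>h\<close> is the left moment of \<open>p\<close>, and \<open>p k\<close> when the
  right moment of \<open>p\<close> is the range of \<open>k\<close>.\<close>

definition left_pairs ::
  "('h, 'u, 'y) groupoid_scheme \<Rightarrow> ('p, 'h, 'k, 'u, 'v, 'z) bimodule_scheme \<Rightarrow> ('h \<times> 'p) set"
  where "left_pairs H P = {(h, p). h \<in> arrows H \<and> p \<in> points P \<and> src H h = left_moment P p}"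

definition right_pairs ::
  "('k, 'v, 'y) groupoid_scheme \<Rightarrow> ('p, 'h, 'k, 'u, 'v, 'z) bimodule_scheme \<Rightarrow> ('p \<times> 'k) set"
  where "right_pairs K P = {(p, k). p \<in> points P \<and> k \<in> arrows K \<and> right_moment P p = rng K k}"

definition left_pair_space ::
  "('h, 'u, 'y) groupoid_scheme \<Rightarrow> ('p, 'h, 'k, 'u, 'v, 'z) bimodule_scheme \<Rightarrow> ('h \<times> 'p) topology"
  where "left_pair_space H P =
    subtopology (prod_topology (arrow_space H) (point_space P)) (left_pairs H P)"

definition right_pair_space ::
  "('k, 'v, 'y) groupoid_scheme \<Rightarrow> ('p, 'h, 'k, 'u, 'v, 'z) bimodule_scheme \<Rightarrow> ('p \<times> 'k) topology"
  where "right_pair_space K P =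
    subtopology (prod_topology (point_space P) (arrow_space K)) (right_pairs K P)"

definition left_orbits ::
  "('h, 'u, 'y) groupoid_scheme \<Rightarrow> ('p, 'h, 'k, 'u, 'v, 'z) bimodule_scheme \<Rightarrow> 'p set set"
  where "left_orbits H P = points P // {(p, left_act P h p) |h p. (h, p) \<in> left_pairs H P}"

definition right_orbits ::
  "('k, 'v, 'y) groupoid_scheme \<Rightarrow> ('p, 'h, 'k, 'u, 'v, 'z) bimodule_scheme \<Rightarrow> 'p set set"
  where "right_orbits K P = points P // {(p, right_act P p k) |p k. (p, k) \<in> right_pairs K P}"

text \<open>The induced map on orbits sends an orbit to the value that the moment map takes on it.\<close>

locale morita_bimodule =
  left: topological_groupoid H + right: topological_groupoid K
  for H :: "('h, 'u, 'x) groupoid_scheme" and K :: "('k, 'v, 'y) groupoid_scheme"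
    and P :: "('p, 'h, 'k, 'u, 'v, 'z) bimodule_scheme" +
  assumes continuous_left_moment:
      "continuous_map (point_space P) (object_space H) (left_moment P)"
    and continuous_left_act:
      "continuous_map (left_pair_space H P) (point_space P) (\<lambda>(h, p). left_act P h p)"
    and left_moment_left_act:
      "(h, p) \<in> left_pairs H P \<Longrightarrow> left_moment P (left_act P h p) = rng H h"
    and left_act_ident:
      "p \<in> points P \<Longrightarrow> left_act P (ident H (left_moment P p)) p = p"
    and left_act_comp: "\<lbrakk>(h, h') \<in> composable_pairs H; (h', p) \<in> left_pairs H P\<rbrakk>
      \<Longrightarrow> left_act P (arrow_comp H h h') p = left_act P h (left_act P h' p)"
    and continuous_right_moment:
      "continuous_map (point_space P) (object_space K) (right_moment P)"
    and continuous_right_act: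
      "continuous_map (right_pair_space K P) (point_space P) (\<lambda>(p, k). right_act P p k)"
    and right_moment_right_act:
      "(p, k) \<in> right_pairs K P \<Longrightarrow> right_moment P (right_act P p k) = src K k"
    and right_act_ident:
      "p \<in> points P \<Longrightarrow> right_act P p (ident K (right_moment P p)) = p"
    and right_act_comp: "\<lbrakk>(p, k) \<in> right_pairs K P; (k, k') \<in> composable_pairs K\<rbrakk>
      \<Longrightarrow> right_act P p (arrow_comp K k k') = right_act P (right_act P p k) k'"
    and right_moment_left_act:
      "(h, p) \<in> left_pairs H P \<Longrightarrow> right_moment P (left_act P h p) = right_moment P p"
    and left_moment_right_act:
      "(p, k) \<in> right_pairs K P \<Longrightarrow> left_moment P (right_act P p k) = left_moment P p"
    and acts_commute: "\<lbrakk>(h, p) \<in> left_pairs H P; (p, k) \<in> right_pairs K P\<rbrakk>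
      \<Longrightarrow> right_act P (left_act P h p) k = left_act P h (right_act P p k)"
    and left_free: "\<lbrakk>(h, p) \<in> left_pairs H P; left_act P h p = p\<rbrakk>
      \<Longrightarrow> h = ident H (left_moment P p)"
    and right_free: "\<lbrakk>(p, k) \<in> right_pairs K P; right_act P p k = p\<rbrakk>
      \<Longrightarrow> k = ident K (right_moment P p)"
    and left_proper: "proper_map (left_pair_space H P) (prod_topology (point_space P) (point_space P))
      (\<lambda>(h, p). (left_act P h p, p))"
    and right_proper: "proper_map (right_pair_space K P) (prod_topology (point_space P) (point_space P))
      (\<lambda>(p, k). (p, right_act P p k))"
    and left_moment_homeomorphic:
      "homeomorphic_map (quotient_space (point_space P) (right_orbits K P)) (object_space H)
        (\<lambda>c. the_elem (left_moment P ` c))"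
    and right_moment_homeomorphic:
      "homeomorphic_map (quotient_space (point_space P) (left_orbits H P)) (object_space K)
        (\<lambda>c. the_elem (right_moment P ` c))"

record ('g, 'p, 'h, 'k, 'u, 'v) G_bimodule = "('p, 'h, 'k, 'u, 'v) bimodule" +
  point_act :: "'g \<Rightarrow> 'p \<Rightarrow> 'p"

text \<open>Equivariance of the moment maps is what makes \<open>g(h) g(p) g(k)\<close> defined whenever \<open>h p k\<close> is.\<close>

locale equivariant_morita_bimodule =
  left: equivariant_groupoid G T H + right: equivariant_groupoid G T K +
  morita_bimodule H K P +
  point_action: continuous_group_action G T "point_space P" "point_act P"
  for G :: "('g, 'm) monoid_scheme" and T :: "'g topology"
    and H :: "('g, 'h, 'u, 'x) G_groupoid_scheme" and K :: "('g, 'k, 'v, 'y) G_groupoid_scheme"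
    and P :: "('g, 'p, 'h, 'k, 'u, 'v, 'z) G_bimodule_scheme" +
  assumes left_moment_act: "\<lbrakk>g \<in> carrier G; p \<in> points P\<rbrakk>
      \<Longrightarrow> left_moment P (point_act P g p) = object_act H g (left_moment P p)"
    and right_moment_act: "\<lbrakk>g \<in> carrier G; p \<in> points P\<rbrakk>
      \<Longrightarrow> right_moment P (point_act P g p) = object_act K g (right_moment P p)"
    and act_equivariant:
      "\<lbrakk>g \<in> carrier G; (h, p) \<in> left_pairs H P; (p, k) \<in> right_pairs K P\<rbrakk>
      \<Longrightarrow> point_act P g (right_act P (left_act P h p) k)
        = right_act P (left_act P (arrow_act H g h) (point_act P g p)) (arrow_act K g k)"

text \<open>The bimodule \<open>G \<times> P\<close> of \<open>G \<ltimes> H\<close> and \<open>G \<ltimes> K\<close>. The moments of \<open>(g, p)\<close> are those for which the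
  products \<open>(g, h) (g', p) = (g g', h \<cdot> g p)\<close> and \<open>(g', p) (g'', k) = (g' g'', p \<cdot> g' k)\<close> are defined.\<close>

definition crossed_bimodule ::
  "('g, 'm) monoid_scheme \<Rightarrow> 'g topology \<Rightarrow> ('g, 'k, 'v, 'y) G_groupoid_scheme
    \<Rightarrow> ('g, 'p, 'h, 'k, 'u, 'v, 'z) G_bimodule_scheme
    \<Rightarrow> ('g \<times> 'p, 'g \<times> 'h, 'g \<times> 'k, 'u, 'v) bimodule"
  where "crossed_bimodule G T K P =
    \<lparr>point_space = prod_topology T (point_space P),
     left_moment = (\<lambda>(g, p). left_moment P p),
     right_moment = (\<lambda>(g, p). object_act K (inv\<^bsub>G\<^esub> g) (right_moment P p)),
     left_act = (\<lambda>(g, h) (g', p). (g \<otimes>\<^bsub>G\<^esub> g', left_act P h (point_act P g p))),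
     right_act = (\<lambda>(g, p) (g', k). (g \<otimes>\<^bsub>G\<^esub> g', right_act P p (arrow_act K g k)))\<rparr>"

definition cohomologous_along ::
  "('h, 'u, 'x) groupoid_scheme \<Rightarrow> ('k, 'v, 'y) groupoid_scheme
    \<Rightarrow> ('p, 'h, 'k, 'u, 'v, 'z) bimodule_scheme
    \<Rightarrow> ('h \<Rightarrow> 'h \<Rightarrow> complex) \<Rightarrow> ('k \<Rightarrow> 'k \<Rightarrow> complex) \<Rightarrow> bool"
  where "cohomologous_along H K P \<psi> \<phi> \<longleftrightarrow> (\<exists>\<mu> \<nu>.
    continuous_map (left_pair_space H P) circle_space (\<lambda>(h, p). \<mu> h p) \<and>
    continuous_map (right_pair_space K P) circle_space (\<lambda>(p, k). \<nu> p k) \<and>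
    (\<forall>h h' p. (h, h') \<in> composable_pairs H \<longrightarrow> (h', p) \<in> left_pairs H P \<longrightarrow>
      \<mu> h' p * inverse (\<mu> (arrow_comp H h h') p) * \<mu> h (left_act P h' p) = \<psi> h h') \<and>
    (\<forall>p k k'. (p, k) \<in> right_pairs K P \<longrightarrow> (k, k') \<in> composable_pairs K \<longrightarrow>
      \<nu> (right_act P p k) k' * inverse (\<nu> p (arrow_comp K k k')) * \<nu> p k = \<phi> k k') \<and>
    (\<forall>h p k. (h, p) \<in> left_pairs H P \<longrightarrow> (p, k) \<in> right_pairs K P \<longrightarrow>
      \<mu> h p * \<nu> (left_act P h p) k = \<nu> p k * \<mu> h (right_act P p k)))"

end

theory Submission
  imports Defs
begin

text \<open>The idea is that the T-dual of \<open>L\<^sub>i = G \<rtimes> N \<rtimes> H\<^sub>i\<close> is a full subgroupoid of \<open>G \<ltimes> L\<^sub>i\<close>. An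
arrow \<open>(g, h, n, x)\<close> of \<open>G \<ltimes> L\<^sub>i\<close> goes from \<open>(g\<inverse> h n \<rho>(x), s x)\<close> to \<open>(h, r x)\<close>, so it joins two
objects over the identity of \<open>G\<close> exactly if \<open>h = 1\<close> and \<open>g = n \<rho>(x)\<close>, that is, if it is \<open>\<iota>(n, x)\<close>.
The objects over the identity form a closed set, and every object has exactly one translate by \<open>G\<close>
in it. Hence the Morita bimodule \<open>G \<times> R\<close> of \<open>G \<ltimes> L\<^sub>1\<close> and \<open>G \<ltimes> L\<^sub>2\<close> restricts to a Morita bimodule
of the two duals, and \<open>\<mu>\<close>, \<open>\<nu>\<close> restrict with it.

A point \<open>(g, p)\<close> of \<open>G \<times> R\<close> has both moments over the identity exactly if the left moment of \<open>p\<close>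
lies over \<open>1\<close> and its right moment over \<open>g\<close>. So \<open>g\<close> is determined by \<open>p\<close>, and the restriction can
be taken to be the closed subspace \<open>S \<subseteq> R\<close> of the points with left moment over \<open>1\<close>, embedded in \<open>G
\<times> R\<close> as a graph. The actions that it inherits are \<open>(n, x) \<cdot> p = (1, n, x) (n \<rho>(x) p)\<close> and \<open>p \<cdot> (n,
y) = p (g, n, y)\<close>. Everything asked of \<open>S\<close> is then inherited from \<open>R\<close> (\<open>morita_bimodule_slice\<close>):
freeness, since the right moment detects the group element \<open>n \<rho>(x)\<close>; properness, since the
arrow-point pairs of \<open>S\<close> embed as closed sets in those of \<open>R\<close>; and the identification of the orbit
spaces, since \<open>G\<close> translates every point of \<open>R\<close> into \<open>S\<close>.

It remains to pass from groupoids to gerbes, which works for every Morita bimodule \<open>P\<close> along which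
two cocycles are cohomologous (\<open>cohomologous_along_imp_morita_gerbes\<close>): the gerbes act on \<open>U(1) \<times>
P\<close> with \<open>\<mu>\<close> and \<open>\<nu>\<close> as multipliers. The three equations relating \<open>\<mu>\<close>, \<open>\<nu>\<close> and the cocycles say
exactly that the left multiplication is an action, the right multiplication is an action, and the
two commute.\<close>


section \<open>Continuity and properness of composite maps\<close>

lemma continuous_map_compose_pointwise:
  assumes "continuous_map Z X f" "continuous_map X W F"
  shows "continuous_map Z W (\<lambda>z. F (f z))"
  using continuous_map_compose[OF assms] by (simp add: o_def)

text \<open>Products of composable arrows and actions are continuous on fibred products only. This lemma
reduces the continuity of an expression built from them to that of its arguments and a matching
condition.\<close>

lemma continuous_map_compose_binary:
  assumes "continuous_map (subtopology (prod_topology X Y) S) W (\<lambda>(x, y). F x y)"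
    and "continuous_map Z X f" "continuous_map Z Y g" "\<And>z. z \<in> topspace Z \<Longrightarrow> (f z, g z) \<in> S"
  shows "continuous_map Z W (\<lambda>z. F (f z) (g z))"
proof -
  have "continuous_map Z (subtopology (prod_topology X Y) S) (\<lambda>z. (f z, g z))"
    using assms by (simp add: continuous_map_in_subtopology continuous_map_paired)
  from continuous_map_compose[OF this assms(1)] show ?thesis by (simp add: o_def)
qed

lemma continuous_map_compose_binary_total:
  assumes "continuous_map (prod_topology X Y) W (\<lambda>(x, y). F x y)"
    and "continuous_map Z X f" "continuous_map Z Y g"
  shows "continuous_map Z W (\<lambda>z. F (f z) (g z))"
  using continuous_map_compose_binary[where S = UNIV] assms by simp

lemma continuous_map_fst_pointwise:
  "continuous_map Z (prod_topology X Y) f \<Longrightarrow> continuous_map Z X (\<lambda>z. fst (f z))"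
  and continuous_map_snd_pointwise:
  "continuous_map Z (prod_topology X Y) f \<Longrightarrow> continuous_map Z Y (\<lambda>z. snd (f z))"
  by (simp_all add: continuous_map_pairwise o_def)

lemma continuous_map_identity: "continuous_map X X (\<lambda>x. x)"
  and continuous_map_subtopology_identity: "continuous_map (subtopology X S) X (\<lambda>x. x)"
  by (simp_all add: continuous_map_from_subtopology)

lemmas continuous_map_pair_intros =
  continuous_map_pairedI continuous_map_fst_pointwise continuous_map_snd_pointwise
  continuous_map_identity continuous_map_subtopology_identity

lemma proper_map_cong:
  assumes "proper_map X Y f" "\<And>x. x \<in> topspace X \<Longrightarrow> f x = g x"
  shows "proper_map X Y g"
proof -
  have "f ` C = g ` C" if "closedin X C" for C
    using closedin_subset[OF that] assms(2) by (intro image_cong) auto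
  moreover have "{x \<in> topspace X. f x = y} = {x \<in> topspace X. g x = y}" for y
    using assms(2) by auto
  ultimately show ?thesis using assms(1) by (simp add: proper_map_def closed_map_def)
qed

lemma proper_map_closed_embedding:
  assumes "continuous_map X Y a" and "continuous_map (subtopology Y C) X b" and "closedin Y C"
    and a: "\<And>x. x \<in> topspace X \<Longrightarrow> a x \<in> C \<and> b (a x) = x"
    and b: "\<And>y. y \<in> C \<Longrightarrow> a (b y) = y"
  shows "proper_map X Y a"
proof -
  have C: "C \<subseteq> topspace Y" by (rule closedin_subset[OF assms(3)])
  have "homeomorphic_maps X (subtopology Y C) a b"
    using assms C by (auto simp: homeomorphic_maps_def continuous_map_in_subtopology)
  then have "proper_map X (subtopology Y C) a"
    using homeomorphic_imp_proper_map homeomorphic_maps_map by blast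
  moreover have "proper_map (subtopology Y C) Y id"
    using assms(3) C by (simp add: proper_map_inclusion closed_Int_compactin)
  ultimately show ?thesis
    using proper_map_compose by fastforce
qed

text \<open>The form in which properness is inherited by a new bimodule: the arrow-point pairs of the
new one map properly to those of the old one, and the pairs of points of the new one inject
continuously.\<close>

lemma proper_map_transfer:
  assumes "proper_map X Y F" and "proper_map X' X a"
    and "continuous_map Y' Y c" and "inj_on c (topspace Y')"
    and "f \<in> topspace X' \<rightarrow> topspace Y'" and "\<And>x. x \<in> topspace X' \<Longrightarrow> F (a x) = c (f x)"
  shows "proper_map X' Y' f"
proof -
  have "proper_map X' Y (F \<circ> a)" by (rule proper_map_compose[OF assms(2,1)])
  then have "proper_map X' Y (c \<circ> f)" by (rule proper_map_cong) (use assms(6) in simp)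
  then show ?thesis using proper_map_from_composition_right_inj assms(3-5) by blast
qed

lemma continuous_map_subtopology_components:
  "continuous_map (prod_topology Z (subtopology (prod_topology X Y) S)) X (\<lambda>z. fst (snd z))"
  "continuous_map (prod_topology Z (subtopology (prod_topology X Y) S)) Y (\<lambda>z. snd (snd z))"
  using continuous_map_compose_pointwise[OF continuous_map_snd
      continuous_map_from_subtopology[OF continuous_map_fst]]
    continuous_map_compose_pointwise[OF continuous_map_snd
      continuous_map_from_subtopology[OF continuous_map_snd]] by auto

lemma proper_map_of_inverse:
  assumes "continuous_map X Y a" "continuous_map Y X b"
    and "\<And>x. x \<in> topspace X \<Longrightarrow> b (a x) = x" "\<And>y. y \<in> topspace Y \<Longrightarrow> a (b y) = y"
  shows "proper_map X Y a"
proof -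
  have "homeomorphic_maps X Y a b" using assms by (simp add: homeomorphic_maps_def)
  then show ?thesis using homeomorphic_imp_proper_map homeomorphic_maps_map by blast
qed


section \<open>Orbit spaces\<close>

text \<open>The condition on the moment maps in a Morita bimodule speaks of a homeomorphism on an orbit
space. In practice it is used, and established, as a statement about the moment map itself: it is
a quotient map whose fibres are the orbits.\<close>

lemma quotient_map_orbit_space:
  assumes "equiv (topspace X) E"
  shows "quotient_map X (quotient_space X (topspace X // E)) (\<lambda>x. E `` {x})"
    and "topspace (quotient_space X (topspace X // E)) = topspace X // E"
proof -
  let ?Q = "quotient_space X (topspace X // E)"
  note class_eq = equiv_class_eq_iff[OF assms]
  have blocks: "topspace X // E = (\<lambda>x. E `` {x}) ` topspace X" by (auto simp: quotient_def)
  have "disjoint (topspace X // E)"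
    using quotient_disj[OF assms] by (auto simp: disjoint_def)
  note open_iff = openin_quotient_space[OF this]
  have union: "\<Union>U = {x \<in> topspace X. E `` {x} \<in> U}" if U: "U \<subseteq> topspace X // E" for U
  proof (intro equalityI subsetI)
    fix x assume "x \<in> \<Union>U"
    then obtain c where c: "c \<in> U" "x \<in> c" by blast
    then obtain y where y: "y \<in> topspace X" "c = E `` {y}" using U blocks by auto
    then have "(y, x) \<in> E" using c by blast
    then show "x \<in> {x \<in> topspace X. E `` {x} \<in> U}" using c y class_eq by auto
  next
    fix x assume "x \<in> {x \<in> topspace X. E `` {x} \<in> U}"
    then show "x \<in> \<Union>U" using equiv_class_self[OF assms] by blast
  qed
  have "\<Union>(topspace X // E) = topspace X" by (rule Union_quotient[OF assms])
  then have "openin ?Q (topspace X // E)" by (simp add: open_iff)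
  then show top: "topspace ?Q = topspace X // E"
    using open_iff openin_subset openin_topspace by (metis subset_antisym)
  show "quotient_map X ?Q (\<lambda>x. E `` {x})"
    unfolding quotient_map_def top by (simp add: open_iff union blocks[symmetric])
qed

lemma homeomorphic_map_orbit_space_iff:
  assumes E: "equiv (topspace X) E" and const: "\<And>x y. (x, y) \<in> E \<Longrightarrow> f x = f y"
  shows "homeomorphic_map (quotient_space X (topspace X // E)) Y (\<lambda>c. the_elem (f ` c))
    \<longleftrightarrow> quotient_map X Y f \<and> (\<forall>x \<in> topspace X. \<forall>y \<in> topspace X. f x = f y \<longrightarrow> (x, y) \<in> E)"
    (is "homeomorphic_map ?Q Y ?h \<longleftrightarrow> ?R")
proof -
  let ?q = "\<lambda>x. E `` {x}"
  note class_eq = equiv_class_eq_iff[OF E]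
  have h_q: "?h (?q x) = f x" if "x \<in> topspace X" for x
  proof -
    have "f y = f x" if "y \<in> ?q x" for y using const[of x y] that by simp
    then have "f ` ?q x \<subseteq> {f x}" by blast
    moreover have "f x \<in> f ` ?q x" by (rule imageI) (rule equiv_class_self[OF E that])
    ultimately have "f ` ?q x = {f x}" by blast
    then show ?thesis by simp
  qed
  have Q: "quotient_map X ?Q ?q" "topspace ?Q = ?q ` topspace X"
    using quotient_map_orbit_space[OF E] by (auto simp: quotient_def)
  have "quotient_map X Y f \<longleftrightarrow> quotient_map X Y (?h \<circ> ?q)"
    by (rule iffI; erule quotient_map_eq; simp add: h_q)
  also have "\<dots> \<longleftrightarrow> quotient_map ?Q Y ?h" using Q(1) by (rule quotient_map_compose_eq)
  finally have quotient: "quotient_map X Y f \<longleftrightarrow> quotient_map ?Q Y ?h" .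
  have "inj_on ?h (topspace ?Q)
    \<longleftrightarrow> (\<forall>x \<in> topspace X. \<forall>y \<in> topspace X. f x = f y \<longrightarrow> (x, y) \<in> E)"
    unfolding inj_on_def Q(2) by (simp add: h_q class_eq)
  then show ?thesis unfolding homeomorphic_map_def quotient by (rule conj_cong[OF refl])
qed

lemma homeomorphic_map_orbit_spaceI:
  assumes "quotient_map X Y f"
    and E: "\<And>x y. (x, y) \<in> E \<longleftrightarrow> x \<in> topspace X \<and> y \<in> topspace X \<and> f x = f y"
  shows "homeomorphic_map (quotient_space X (topspace X // E)) Y (\<lambda>c. the_elem (f ` c))"
proof -
  have "equiv (topspace X) E"
    by (auto simp: equiv_def refl_on_def sym_def trans_def E)
  from homeomorphic_map_orbit_space_iff[OF this, where f = f and Y = Y] show ?thesis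
    using assms by blast
qed


section \<open>Gerbes\<close>

lemma continuous_map_circle_mult:
  assumes "continuous_map Z circle_space f" "continuous_map Z circle_space g"
  shows "continuous_map Z circle_space (\<lambda>z. f z * g z)"
proof -
  have "continuous_on (sphere 0 1 \<times> sphere 0 1) (\<lambda>(s, t). s * t :: complex)"
    by (auto intro!: continuous_intros simp: split_beta)
  then have "continuous_map (prod_topology circle_space circle_space) circle_space
      (\<lambda>(s, t). s * t)"
    by (auto simp: prod_topology_subtopology subtopology_subtopology continuous_map_in_subtopology
        norm_mult Times_Int_Times)
  from continuous_map_compose_binary_total[OF this assms] show ?thesis .
qed

lemma continuous_map_circle_inverse:
  assumes "continuous_map Z circle_space f"
  shows "continuous_map Z circle_space (\<lambda>z. inverse (f z))"
proof -
  have "continuous_map circle_space circle_space (\<lambda>s. inverse s)"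
    by (auto simp: continuous_map_in_subtopology norm_inverse intro!: continuous_intros)
  from continuous_map_compose_pointwise[OF assms this] show ?thesis .
qed

lemma circle_memberD:
  assumes "continuous_map X circle_space f" "x \<in> topspace X"
  shows "norm (f x) = 1"
  using continuous_map_funspace[OF assms(1)] assms(2) by (auto simp: dist_norm)

lemma circle_nonzero: "norm (z :: complex) = 1 \<Longrightarrow> z \<noteq> 0"
  by auto

lemma circle_space_nontrivial: "circle_space \<noteq> trivial_topology"
  by (simp flip: null_topspace_iff_trivial)

lemma topspace_composable_space: "topspace (composable_space H) = composable_pairs H"
  by (auto simp: composable_space_def composable_pairs_def)

context topological_groupoid
begin

lemma src_in_objects: "x \<in> arrows H \<Longrightarrow> src H x \<in> objects H"
  and rng_in_objects: "x \<in> arrows H \<Longrightarrow> rng H x \<in> objects H"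
  and ident_in_arrows: "u \<in> objects H \<Longrightarrow> ident H u \<in> arrows H"
  and inverse_in_arrows: "x \<in> arrows H \<Longrightarrow> inverse_arrow H x \<in> arrows H"
  using continuous_src continuous_rng continuous_ident continuous_inverse
  by (auto dest!: continuous_map_funspace)

lemma comp_in_arrows: "(x, y) \<in> composable_pairs H \<Longrightarrow> arrow_comp H x y \<in> arrows H"
  using continuous_map_funspace[OF continuous_comp]
  by (auto simp: topspace_composable_space dest: funcset_mem)

end

lemma gerbe_groupoid_select [simp]:
  "arrow_space (gerbe_groupoid H \<psi>) = prod_topology circle_space (arrow_space H)"
  "object_space (gerbe_groupoid H \<psi>) = object_space H"
  "src (gerbe_groupoid H \<psi>) = (\<lambda>a. src H (snd a))"
  "rng (gerbe_groupoid H \<psi>) = (\<lambda>a. rng H (snd a))"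
  "arrow_comp (gerbe_groupoid H \<psi>) =
    (\<lambda>a b. (fst a * fst b * \<psi> (snd a) (snd b), arrow_comp H (snd a) (snd b)))"
  "ident (gerbe_groupoid H \<psi>) = (\<lambda>u. (inverse (\<psi> (ident H u) (ident H u)), ident H u))"
  "inverse_arrow (gerbe_groupoid H \<psi>) =
    (\<lambda>a. (inverse (fst a * \<psi> (snd a) (inverse_arrow H (snd a)) *
        \<psi> (ident H (rng H (snd a))) (ident H (rng H (snd a)))), inverse_arrow H (snd a)))"
  by (auto simp: gerbe_groupoid_def split_beta fun_eq_iff)

lemma composable_pairs_gerbe_groupoid:
  "(a, b) \<in> composable_pairs (gerbe_groupoid H \<psi>) \<longleftrightarrow>
    norm (fst a) = 1 \<and> norm (fst b) = 1 \<and> (snd a, snd b) \<in> composable_pairs H"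
  by (cases a; cases b) (auto simp: composable_pairs_def)

text \<open>Even if the cocycle is not normalized, \<open>\<psi>(1, x)\<close> and \<open>\<psi>(x, 1)\<close> depend only on an end of \<open>x\<close>:
they are the values \<open>\<psi>(1, 1)\<close>, for the unit at the range of \<open>x\<close> and the unit at its source. This
is what makes \<open>\<psi>(1, 1)\<inverse>\<close> the circle component of the units, and the comparison of \<open>\<psi>(x\<inverse>, x)\<close> with
\<open>\<psi>(x, x\<inverse>)\<close> makes the right inverses two-sided.\<close>

lemma topological_groupoid_gerbe_groupoid:
  assumes "topological_groupoid H"
    and \<psi>: "continuous_map (composable_space H) circle_space (\<lambda>(x, y). \<psi> x y)"
    and cocycle: "\<And>x y z. (x, y) \<in> composable_pairs H \<Longrightarrow> (y, z) \<in> composable_pairs H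
      \<Longrightarrow> \<psi> x y * \<psi> (arrow_comp H x y) z = \<psi> y z * \<psi> x (arrow_comp H y z)"
  shows "topological_groupoid (gerbe_groupoid H \<psi>)"
proof -
  interpret topological_groupoid H by fact
  have composable: "(x, y) \<in> composable_pairs H \<longleftrightarrow> x \<in> arrows H \<and> y \<in> arrows H \<and> src H x = rng H y"
    for x y by (auto simp: composable_pairs_def)
  have norm_psi: "norm (\<psi> x y) = 1" if "(x, y) \<in> composable_pairs H" for x y
    using circle_memberD[OF \<psi>, of "(x, y)"] that by (simp add: topspace_composable_space)
  then have nz: "\<psi> x y \<noteq> 0" if "(x, y) \<in> composable_pairs H" for x y
    using that by fastforce
  note basics = src_in_objects rng_in_objects ident_in_arrows inverse_in_arrows src_ident
    rng_ident src_inverse rng_inverse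
  \<comment> \<open>The cocycle identity at \<open>(1, 1, x)\<close>.\<close>
  have psi_ident_left: "\<psi> (ident H (rng H x)) x = \<psi> (ident H (rng H x)) (ident H (rng H x))"
    if "x \<in> arrows H" for x
    using cocycle[of "ident H (rng H x)" "ident H (rng H x)" x] that nz
      ident_comp[of "ident H (rng H x)"]
    by (simp add: composable basics ident_comp)
  \<comment> \<open>The cocycle identity at \<open>(x, 1, 1)\<close>.\<close>
  have psi_ident_right: "\<psi> x (ident H (src H x)) = \<psi> (ident H (src H x)) (ident H (src H x))"
    if "x \<in> arrows H" for x
    using cocycle[of x "ident H (src H x)" "ident H (src H x)"] that nz
      ident_comp[of "ident H (src H x)"]
    by (simp add: composable basics comp_ident)
  \<comment> \<open>The cocycle identity at \<open>(x, x\<inverse>, x)\<close>.\<close>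
  have psi_inverse: "\<psi> (inverse_arrow H x) x * \<psi> (ident H (src H x)) (ident H (src H x))
      = \<psi> x (inverse_arrow H x) * \<psi> (ident H (rng H x)) (ident H (rng H x))"
    if "x \<in> arrows H" for x
    using cocycle[of x "inverse_arrow H x" x] that
    by (simp add: composable basics comp_inverse inverse_comp psi_ident_left psi_ident_right)
  have cont_psi: "continuous_map Z circle_space (\<lambda>z. \<psi> (f z) (g z))"
    and cont_comp: "continuous_map Z (arrow_space H) (\<lambda>z. arrow_comp H (f z) (g z))"
    if "continuous_map Z (arrow_space H) f" "continuous_map Z (arrow_space H) g"
      "\<And>z. z \<in> topspace Z \<Longrightarrow> src H (f z) = rng H (g z)"
    for Z :: "'z topology" and f g
  proof -
    have "(f z, g z) \<in> composable_pairs H" if "z \<in> topspace Z" for z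
      using that \<open>\<And>z. z \<in> topspace Z \<Longrightarrow> src H (f z) = rng H (g z)\<close>
        continuous_map_funspace[OF \<open>continuous_map Z (arrow_space H) f\<close>]
        continuous_map_funspace[OF \<open>continuous_map Z (arrow_space H) g\<close>]
      by (auto simp: composable)
    then show "continuous_map Z circle_space (\<lambda>z. \<psi> (f z) (g z))"
      "continuous_map Z (arrow_space H) (\<lambda>z. arrow_comp H (f z) (g z))"
      using continuous_map_compose_binary[OF \<psi>[unfolded composable_space_def] that(1,2)]
        continuous_map_compose_binary[OF continuous_comp[unfolded composable_space_def] that(1,2)]
      by blast+
  qed
  note cont = continuous_map_pair_intros continuous_map_circle_mult continuous_map_circle_inverse
    cont_psi cont_comp continuous_ident continuous_map_compose_pointwise[OF _ continuous_ident]
    continuous_map_compose_pointwise[OF _ continuous_inverse]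
    continuous_map_compose_pointwise[OF _ continuous_rng]
    continuous_map_compose_pointwise[OF _ continuous_src]
  show ?thesis
  proof (unfold_locales; unfold composable_pairs_gerbe_groupoid gerbe_groupoid_select fst_conv snd_conv)
    show "continuous_map (prod_topology circle_space (arrow_space H)) (object_space H)
        (\<lambda>a. src H (snd a))"
      "continuous_map (prod_topology circle_space (arrow_space H)) (object_space H)
        (\<lambda>a. rng H (snd a))"
      by (rule cont)+
    show "continuous_map (composable_space (gerbe_groupoid H \<psi>))
        (prod_topology circle_space (arrow_space H))
        (\<lambda>(x, y). (fst x * fst y * \<psi> (snd x) (snd y), arrow_comp H (snd x) (snd y)))"
      unfolding split_beta composable_space_def gerbe_groupoid_select
      by (rule cont | force simp: composable_pairs_def)+
    show "continuous_map (object_space H) (prod_topology circle_space (arrow_space H))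
        (\<lambda>u. (inverse (\<psi> (ident H u) (ident H u)), ident H u))"
      by (rule cont | force simp: basics)+
    show "continuous_map (prod_topology circle_space (arrow_space H))
        (prod_topology circle_space (arrow_space H))
        (\<lambda>a. (inverse (fst a * \<psi> (snd a) (inverse_arrow H (snd a)) *
          \<psi> (ident H (rng H (snd a))) (ident H (rng H (snd a)))), inverse_arrow H (snd a)))"
      by (rule cont | force simp: basics)+
  qed (auto simp: src_comp rng_comp comp_assoc basics ident_comp comp_ident inverse_comp
      comp_inverse psi_ident_left psi_ident_right field_simps composable nz
      cocycle[unfolded composable] psi_inverse)
qed


section \<open>Orbits of a bimodule\<close>

context morita_bimodule
begin

lemma left_pairs_iff:
  "(h, p) \<in> left_pairs H P \<longleftrightarrow> h \<in> arrows H \<and> p \<in> points P \<and> src H h = left_moment P p"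
  and right_pairs_iff:
  "(p, k) \<in> right_pairs K P \<longleftrightarrow> p \<in> points P \<and> k \<in> arrows K \<and> right_moment P p = rng K k"
  by (auto simp: left_pairs_def right_pairs_def)

lemma left_moment_in_objects: "p \<in> points P \<Longrightarrow> left_moment P p \<in> objects H"
  and right_moment_in_objects: "p \<in> points P \<Longrightarrow> right_moment P p \<in> objects K"
  using continuous_left_moment continuous_right_moment by (auto dest!: continuous_map_funspace)

lemma topspace_left_pair_space: "topspace (left_pair_space H P) = left_pairs H P"
  and topspace_right_pair_space: "topspace (right_pair_space K P) = right_pairs K P"
  by (auto simp: left_pair_space_def right_pair_space_def left_pairs_def right_pairs_def)

lemma left_act_in_points: "(h, p) \<in> left_pairs H P \<Longrightarrow> left_act P h p \<in> points P"
  using continuous_map_funspace[OF continuous_left_act]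
  by (auto simp: topspace_left_pair_space dest: funcset_mem)

lemma right_act_in_points: "(p, k) \<in> right_pairs K P \<Longrightarrow> right_act P p k \<in> points P"
  using continuous_map_funspace[OF continuous_right_act]
  by (auto simp: topspace_right_pair_space dest: funcset_mem)

lemma equiv_left_orbit_relation:
  "equiv (points P) {(p, left_act P h p) |h p. (h, p) \<in> left_pairs H P}" (is "equiv _ ?E")
proof -
  have sub: "?E \<subseteq> points P \<times> points P" by (auto simp: left_act_in_points left_pairs_iff)
  have "(p, p) \<in> ?E" if "p \<in> points P" for p
  proof -
    have "(ident H (left_moment P p), p) \<in> left_pairs H P" using that
      by (simp add: left_pairs_iff left_moment_in_objects left.ident_in_arrows left.src_ident)
    then show ?thesis using left_act_ident[OF that] by force
  qed
  moreover have "(q, p) \<in> ?E" if "(p, q) \<in> ?E" for p q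
  proof -
    from that obtain h where h: "(h, p) \<in> left_pairs H P" "q = left_act P h p" by blast
    have i: "(inverse_arrow H h, q) \<in> left_pairs H P" using h
      by (simp add: left_pairs_iff left_act_in_points left.inverse_in_arrows left.src_inverse
          left_moment_left_act)
    have "left_act P (inverse_arrow H h) q = p"
      using h left_act_comp[of "inverse_arrow H h" h p] left_act_ident[of p]
      by (simp add: left_pairs_iff composable_pairs_def left.inverse_in_arrows left.src_inverse
          left.inverse_comp)
    then show ?thesis using i by force
  qed
  moreover have "(p, r) \<in> ?E" if "(p, q) \<in> ?E" "(q, r) \<in> ?E" for p q r
  proof -
    from that obtain h h' where h: "(h, p) \<in> left_pairs H P" "q = left_act P h p"
      "(h', q) \<in> left_pairs H P" "r = left_act P h' q" by blast
    then have c: "(h', h) \<in> composable_pairs H"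
      by (simp add: left_pairs_iff composable_pairs_def left_moment_left_act)
    then have "(arrow_comp H h' h, p) \<in> left_pairs H P" "left_act P (arrow_comp H h' h) p = r"
      using h left_act_comp by (auto simp: left_pairs_iff left.comp_in_arrows left.src_comp)
    then show ?thesis by force
  qed
  ultimately show ?thesis using sub
    by (intro equivI refl_onI symI transI) blast+
qed

lemma equiv_right_orbit_relation:
  "equiv (points P) {(p, right_act P p k) |p k. (p, k) \<in> right_pairs K P}" (is "equiv _ ?E")
proof -
  have sub: "?E \<subseteq> points P \<times> points P" by (auto simp: right_act_in_points right_pairs_iff)
  have "(p, p) \<in> ?E" if "p \<in> points P" for p
  proof -
    have "(p, ident K (right_moment P p)) \<in> right_pairs K P" using that
      by (simp add: right_pairs_iff right_moment_in_objects right.ident_in_arrows right.rng_ident)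
    then show ?thesis using right_act_ident[OF that] by force
  qed
  moreover have "(q, p) \<in> ?E" if "(p, q) \<in> ?E" for p q
  proof -
    from that obtain k where k: "(p, k) \<in> right_pairs K P" "q = right_act P p k" by blast
    have i: "(q, inverse_arrow K k) \<in> right_pairs K P" using k
      by (simp add: right_pairs_iff right_act_in_points right.inverse_in_arrows right.rng_inverse
          right_moment_right_act)
    have "right_act P q (inverse_arrow K k) = p"
      using k right_act_comp[of p k "inverse_arrow K k"] right_act_ident[of p]
      by (simp add: right_pairs_iff composable_pairs_def right.inverse_in_arrows right.rng_inverse
          right.comp_inverse)
    then show ?thesis using i by force
  qed
  moreover have "(p, r) \<in> ?E" if "(p, q) \<in> ?E" "(q, r) \<in> ?E" for p q r
  proof -
    from that obtain k k' where k: "(p, k) \<in> right_pairs K P" "q = right_act P p k"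
      "(q, k') \<in> right_pairs K P" "r = right_act P q k'" by blast
    then have c: "(k, k') \<in> composable_pairs K"
      by (simp add: right_pairs_iff composable_pairs_def right_moment_right_act)
    then have "(p, arrow_comp K k k') \<in> right_pairs K P" "right_act P p (arrow_comp K k k') = r"
      using k right_act_comp by (auto simp: right_pairs_iff right.comp_in_arrows right.rng_comp)
    then show ?thesis by force
  qed
  ultimately show ?thesis using sub
    by (intro equivI refl_onI symI transI) blast+
qed

lemma quotient_map_left_moment:
  "quotient_map (point_space P) (object_space H) (left_moment P)"
  and left_moment_eqD: "\<lbrakk>p \<in> points P; q \<in> points P; left_moment P p = left_moment P q\<rbrakk>
    \<Longrightarrow> \<exists>k. (p, k) \<in> right_pairs K P \<and> right_act P p k = q"
proof -
  have "quotient_map (point_space P) (object_space H) (left_moment P) \<and>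
    (\<forall>p \<in> points P. \<forall>q \<in> points P. left_moment P p = left_moment P q \<longrightarrow>
      (p, q) \<in> {(p, right_act P p k) |p k. (p, k) \<in> right_pairs K P})"
    by (subst homeomorphic_map_orbit_space_iff[OF equiv_right_orbit_relation, symmetric])
      (use left_moment_homeomorphic left_moment_right_act in \<open>auto simp: right_orbits_def\<close>)
  then show "quotient_map (point_space P) (object_space H) (left_moment P)"
    and "\<lbrakk>p \<in> points P; q \<in> points P; left_moment P p = left_moment P q\<rbrakk>
      \<Longrightarrow> \<exists>k. (p, k) \<in> right_pairs K P \<and> right_act P p k = q"
    by blast+
qed

lemma quotient_map_right_moment:
  "quotient_map (point_space P) (object_space K) (right_moment P)"
  and right_moment_eqD: "\<lbrakk>p \<in> points P; q \<in> points P; right_moment P p = right_moment P q\<rbrakk>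
    \<Longrightarrow> \<exists>h. (h, p) \<in> left_pairs H P \<and> left_act P h p = q"
proof -
  have "quotient_map (point_space P) (object_space K) (right_moment P) \<and>
    (\<forall>p \<in> points P. \<forall>q \<in> points P. right_moment P p = right_moment P q \<longrightarrow>
      (p, q) \<in> {(p, left_act P h p) |h p. (h, p) \<in> left_pairs H P})"
    by (subst homeomorphic_map_orbit_space_iff[OF equiv_left_orbit_relation, symmetric])
      (use right_moment_homeomorphic right_moment_left_act in \<open>auto simp: left_orbits_def\<close>)
  then show "quotient_map (point_space P) (object_space K) (right_moment P)"
    and "\<lbrakk>p \<in> points P; q \<in> points P; right_moment P p = right_moment P q\<rbrakk>
      \<Longrightarrow> \<exists>h. (h, p) \<in> left_pairs H P \<and> left_act P h p = q"
    by blast+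
qed

end


section \<open>Twisting a bimodule by cochains on its actions\<close>

definition circle_bimodule ::
  "('p, 'h, 'k, 'u, 'v, 'z) bimodule_scheme \<Rightarrow> ('h \<Rightarrow> 'p \<Rightarrow> complex) \<Rightarrow> ('p \<Rightarrow> 'k \<Rightarrow> complex)
    \<Rightarrow> (complex \<times> 'p, complex \<times> 'h, complex \<times> 'k, 'u, 'v) bimodule"
  where "circle_bimodule P \<mu> \<nu> =
    \<lparr>point_space = prod_topology circle_space (point_space P),
     left_moment = (\<lambda>q. left_moment P (snd q)),
     right_moment = (\<lambda>q. right_moment P (snd q)),
     left_act = (\<lambda>a q. (fst a * fst q * \<mu> (snd a) (snd q), left_act P (snd a) (snd q))),
     right_act = (\<lambda>q b. (fst q * fst b * \<nu> (snd q) (snd b), right_act P (snd q) (snd b)))\<rparr>"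

lemma circle_bimodule_select [simp]:
  "point_space (circle_bimodule P \<mu> \<nu>) = prod_topology circle_space (point_space P)"
  "left_moment (circle_bimodule P \<mu> \<nu>) = (\<lambda>q. left_moment P (snd q))"
  "right_moment (circle_bimodule P \<mu> \<nu>) = (\<lambda>q. right_moment P (snd q))"
  "left_act (circle_bimodule P \<mu> \<nu>) =
    (\<lambda>a q. (fst a * fst q * \<mu> (snd a) (snd q), left_act P (snd a) (snd q)))"
  "right_act (circle_bimodule P \<mu> \<nu>) =
    (\<lambda>q b. (fst q * fst b * \<nu> (snd q) (snd b), right_act P (snd q) (snd b)))"
  by (simp_all add: circle_bimodule_def)

lemma left_pairs_circle_bimodule:
  "(a, q) \<in> left_pairs (gerbe_groupoid H \<psi>) (circle_bimodule P \<mu> \<nu>) \<longleftrightarrow>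
    norm (fst a) = 1 \<and> norm (fst q) = 1 \<and> (snd a, snd q) \<in> left_pairs H P"
  by (cases a; cases q) (auto simp: left_pairs_def)

lemma right_pairs_circle_bimodule:
  "(q, b) \<in> right_pairs (gerbe_groupoid K \<phi>) (circle_bimodule P \<mu> \<nu>) \<longleftrightarrow>
    norm (fst q) = 1 \<and> norm (fst b) = 1 \<and> (snd q, snd b) \<in> right_pairs K P"
  by (cases b; cases q) (auto simp: right_pairs_def)

locale twisted_morita_bimodule = morita_bimodule H K P
  for H :: "('h, 'u, 'x) groupoid_scheme" and K :: "('k, 'v, 'y) groupoid_scheme"
    and P :: "('p, 'h, 'k, 'u, 'v, 'z) bimodule_scheme" +
  fixes \<psi> :: "'h \<Rightarrow> 'h \<Rightarrow> complex" and \<phi> :: "'k \<Rightarrow> 'k \<Rightarrow> complex"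
    and \<mu> :: "'h \<Rightarrow> 'p \<Rightarrow> complex" and \<nu> :: "'p \<Rightarrow> 'k \<Rightarrow> complex"
  assumes continuous_psi: "continuous_map (composable_space H) circle_space (\<lambda>(x, y). \<psi> x y)"
    and continuous_phi: "continuous_map (composable_space K) circle_space (\<lambda>(x, y). \<phi> x y)"
    and continuous_mu: "continuous_map (left_pair_space H P) circle_space (\<lambda>(h, p). \<mu> h p)"
    and continuous_nu: "continuous_map (right_pair_space K P) circle_space (\<lambda>(p, k). \<nu> p k)"
    and mu_cocycle: "\<lbrakk>(h, h') \<in> composable_pairs H; (h', p) \<in> left_pairs H P\<rbrakk>
      \<Longrightarrow> \<mu> h' p * inverse (\<mu> (arrow_comp H h h') p) * \<mu> h (left_act P h' p) = \<psi> h h'"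
    and nu_cocycle: "\<lbrakk>(p, k) \<in> right_pairs K P; (k, k') \<in> composable_pairs K\<rbrakk>
      \<Longrightarrow> \<nu> (right_act P p k) k' * inverse (\<nu> p (arrow_comp K k k')) * \<nu> p k = \<phi> k k'"
    and mu_nu_commute: "\<lbrakk>(h, p) \<in> left_pairs H P; (p, k) \<in> right_pairs K P\<rbrakk>
      \<Longrightarrow> \<mu> h p * \<nu> (left_act P h p) k = \<nu> p k * \<mu> h (right_act P p k)"
begin

lemma norm_mu: "(h, p) \<in> left_pairs H P \<Longrightarrow> norm (\<mu> h p) = 1"
  using circle_memberD[OF continuous_mu, of "(h, p)"] by (simp add: topspace_left_pair_space)

lemma norm_nu: "(p, k) \<in> right_pairs K P \<Longrightarrow> norm (\<nu> p k) = 1"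
  using circle_memberD[OF continuous_nu, of "(p, k)"] by (simp add: topspace_right_pair_space)

lemma mu_nonzero: "(h, p) \<in> left_pairs H P \<Longrightarrow> \<mu> h p \<noteq> 0"
  and nu_nonzero: "(p, k) \<in> right_pairs K P \<Longrightarrow> \<nu> p k \<noteq> 0"
  using norm_mu norm_nu by fastforce+

lemma comp_left_pairs: "\<lbrakk>(h, h') \<in> composable_pairs H; (h', p) \<in> left_pairs H P\<rbrakk>
    \<Longrightarrow> (arrow_comp H h h', p) \<in> left_pairs H P \<and> (h, left_act P h' p) \<in> left_pairs H P"
  by (simp add: left_pairs_iff left.comp_in_arrows left.src_comp left_act_in_points
      left_moment_left_act) (simp add: composable_pairs_def)

lemma comp_right_pairs: "\<lbrakk>(p, k) \<in> right_pairs K P; (k, k') \<in> composable_pairs K\<rbrakk>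
    \<Longrightarrow> (p, arrow_comp K k k') \<in> right_pairs K P \<and> (right_act P p k, k') \<in> right_pairs K P"
  by (simp add: right_pairs_iff right.comp_in_arrows right.rng_comp right_act_in_points
      right_moment_right_act) (simp add: composable_pairs_def)

lemma mu_comp: "\<lbrakk>(h, h') \<in> composable_pairs H; (h', p) \<in> left_pairs H P\<rbrakk>
    \<Longrightarrow> \<psi> h h' * \<mu> (arrow_comp H h h') p = \<mu> h' p * \<mu> h (left_act P h' p)"
  using mu_cocycle[of h h' p] comp_left_pairs[of h h' p] mu_nonzero
  by (auto simp: field_simps)

lemma nu_comp: "\<lbrakk>(p, k) \<in> right_pairs K P; (k, k') \<in> composable_pairs K\<rbrakk>
    \<Longrightarrow> \<phi> k k' * \<nu> p (arrow_comp K k k') = \<nu> p k * \<nu> (right_act P p k) k'"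
  using nu_cocycle[of p k k'] comp_right_pairs[of p k k'] nu_nonzero
  by (auto simp: field_simps)

text \<open>\<open>\<mu>\<close> exhibits the pullback of \<open>\<psi>\<close> to the action groupoid on the points as a coboundary, which
is a cocycle. Since the left moment map is surjective, every composable triple is the image of one
in the action groupoid.\<close>

lemma psi_cocycle:
  assumes xy: "(x, y) \<in> composable_pairs H" and yz: "(y, z) \<in> composable_pairs H"
  shows "\<psi> x y * \<psi> (arrow_comp H x y) z = \<psi> y z * \<psi> x (arrow_comp H y z)"
proof -
  have "src H z \<in> objects H" using yz left.src_in_objects by (auto simp: composable_pairs_def)
  then have "src H z \<in> left_moment P ` points P"
    using quotient_map_left_moment by (simp add: quotient_map_def)
  then obtain p where "p \<in> points P" "src H z = left_moment P p" by blast
  then have z: "(z, p) \<in> left_pairs H P" using yz by (auto simp: left_pairs_iff composable_pairs_def)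
  have xy_z: "(arrow_comp H x y, z) \<in> composable_pairs H"
    and x_yz: "(x, arrow_comp H y z) \<in> composable_pairs H"
    using xy yz by (auto simp: composable_pairs_def left.comp_in_arrows left.src_comp left.rng_comp)
  note pairs = comp_left_pairs[OF yz z] comp_left_pairs[OF xy_z z]
  have "\<psi> x y * \<psi> (arrow_comp H x y) z * \<mu> (arrow_comp H (arrow_comp H x y) z) p
      = \<mu> z p * (\<psi> x y * \<mu> (arrow_comp H x y) (left_act P z p))"
    using mu_comp[OF xy_z z] by simp
  also have "\<dots> = \<mu> z p * (\<mu> y (left_act P z p) * \<mu> x (left_act P (arrow_comp H y z) p))"
    using mu_comp[OF xy] pairs left_act_comp[OF yz z] by simp
  also have "\<dots> = \<psi> y z * \<psi> x (arrow_comp H y z) * \<mu> (arrow_comp H x (arrow_comp H y z)) p"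
    using mu_comp[OF yz z] mu_comp[OF x_yz] pairs by (simp add: mult_ac)
  finally show ?thesis using pairs mu_nonzero left.comp_assoc[OF xy yz] by simp
qed

lemma phi_cocycle:
  assumes xy: "(x, y) \<in> composable_pairs K" and yz: "(y, z) \<in> composable_pairs K"
  shows "\<phi> x y * \<phi> (arrow_comp K x y) z = \<phi> y z * \<phi> x (arrow_comp K y z)"
proof -
  have "rng K x \<in> objects K" using xy right.rng_in_objects by (auto simp: composable_pairs_def)
  then have "rng K x \<in> right_moment P ` points P"
    using quotient_map_right_moment by (simp add: quotient_map_def)
  then obtain p where "p \<in> points P" "rng K x = right_moment P p" by blast
  then have x: "(p, x) \<in> right_pairs K P" using xy by (auto simp: right_pairs_iff composable_pairs_def)
  have xy_z: "(arrow_comp K x y, z) \<in> composable_pairs K"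
    and x_yz: "(x, arrow_comp K y z) \<in> composable_pairs K"
    using xy yz by (auto simp: composable_pairs_def right.comp_in_arrows right.src_comp right.rng_comp)
  note pairs = comp_right_pairs[OF x xy] comp_right_pairs[OF x x_yz]
  have "\<phi> x y * \<phi> (arrow_comp K x y) z * \<nu> p (arrow_comp K (arrow_comp K x y) z)
      = \<phi> x y * \<nu> p (arrow_comp K x y) * \<nu> (right_act P p (arrow_comp K x y)) z"
    using nu_comp[OF _ xy_z, of p] pairs by simp
  also have "\<dots> = \<nu> p x * (\<nu> (right_act P p x) y * \<nu> (right_act P (right_act P p x) y) z)"
    using nu_comp[OF x xy] right_act_comp[OF x xy] by simp
  also have "\<dots> = \<phi> y z * \<phi> x (arrow_comp K y z) * \<nu> p (arrow_comp K x (arrow_comp K y z))"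
    using nu_comp[OF x x_yz] nu_comp[OF _ yz] pairs by (simp add: mult_ac)
  finally show ?thesis using pairs nu_nonzero right.comp_assoc[OF xy yz] by simp
qed

lemma continuous_left_components:
  fixes Z :: "'w topology"
  assumes f: "continuous_map Z (arrow_space H) f" and g: "continuous_map Z (point_space P) g"
    and eq: "\<And>z. z \<in> topspace Z \<Longrightarrow> src H (f z) = left_moment P (g z)"
  shows "continuous_map Z circle_space (\<lambda>z. \<mu> (f z) (g z))"
    and "continuous_map Z (point_space P) (\<lambda>z. left_act P (f z) (g z))"
proof -
  have "(f z, g z) \<in> left_pairs H P" if "z \<in> topspace Z" for z
    using that eq continuous_map_funspace[OF f] continuous_map_funspace[OF g]
    by (auto simp: left_pairs_iff)
  then show "continuous_map Z circle_space (\<lambda>z. \<mu> (f z) (g z))"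
    and "continuous_map Z (point_space P) (\<lambda>z. left_act P (f z) (g z))"
    using continuous_map_compose_binary[OF continuous_mu[unfolded left_pair_space_def] f g]
      continuous_map_compose_binary[OF continuous_left_act[unfolded left_pair_space_def] f g]
    by blast+
qed

lemma continuous_right_components:
  fixes Z :: "'w topology"
  assumes f: "continuous_map Z (point_space P) f" and g: "continuous_map Z (arrow_space K) g"
    and eq: "\<And>z. z \<in> topspace Z \<Longrightarrow> right_moment P (f z) = rng K (g z)"
  shows "continuous_map Z circle_space (\<lambda>z. \<nu> (f z) (g z))"
    and "continuous_map Z (point_space P) (\<lambda>z. right_act P (f z) (g z))"
proof -
  have "(f z, g z) \<in> right_pairs K P" if "z \<in> topspace Z" for z
    using that eq continuous_map_funspace[OF f] continuous_map_funspace[OF g]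
    by (auto simp: right_pairs_iff)
  then show "continuous_map Z circle_space (\<lambda>z. \<nu> (f z) (g z))"
    and "continuous_map Z (point_space P) (\<lambda>z. right_act P (f z) (g z))"
    using continuous_map_compose_binary[OF continuous_nu[unfolded right_pair_space_def] f g]
      continuous_map_compose_binary[OF continuous_right_act[unfolded right_pair_space_def] f g]
    by blast+
qed

lemmas continuous_components = continuous_map_subtopology_components
  continuous_map_pair_intros continuous_map_circle_mult continuous_map_circle_inverse
  continuous_left_components continuous_right_components
  continuous_map_compose_pointwise[OF _ continuous_left_moment]
  continuous_map_compose_pointwise[OF _ continuous_right_moment]

abbreviation "gerbe_left \<equiv> gerbe_groupoid H \<psi>"
abbreviation "gerbe_right \<equiv> gerbe_groupoid K \<phi>"
abbreviation "twist \<equiv> circle_bimodule P \<mu> \<nu>"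

text \<open>Together with freeness of the action on \<open>P\<close> this identifies the stabilizers in the gerbe: an
element fixing \<open>(z, p)\<close> has circle component \<open>\<mu>(1, p)\<inverse>\<close>, and this is the one of a unit.\<close>

lemma mu_ident: "p \<in> points P
    \<Longrightarrow> \<mu> (ident H (left_moment P p)) p = \<psi> (ident H (left_moment P p)) (ident H (left_moment P p))"
proof -
  assume p: "p \<in> points P"
  let ?e = "ident H (left_moment P p)"
  have e: "?e \<in> arrows H" "src H ?e = left_moment P p" "rng H ?e = left_moment P p"
    using p by (simp_all add: left_moment_in_objects left.ident_in_arrows left.src_ident left.rng_ident)
  have "arrow_comp H ?e ?e = ?e" using left.ident_comp[OF e(1)] e(3) by simp
  moreover have "(?e, p) \<in> left_pairs H P" using e p by (simp add: left_pairs_iff)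
  ultimately show ?thesis
    using mu_comp[of ?e ?e p] e p mu_nonzero[of ?e p]
    by (simp add: composable_pairs_def left_act_ident)
qed

lemma nu_ident: "p \<in> points P
    \<Longrightarrow> \<nu> p (ident K (right_moment P p)) = \<phi> (ident K (right_moment P p)) (ident K (right_moment P p))"
proof -
  assume p: "p \<in> points P"
  let ?e = "ident K (right_moment P p)"
  have e: "?e \<in> arrows K" "src K ?e = right_moment P p" "rng K ?e = right_moment P p"
    using p by (simp_all add: right_moment_in_objects right.ident_in_arrows right.src_ident
        right.rng_ident)
  have "arrow_comp K ?e ?e = ?e" using right.ident_comp[OF e(1)] e(3) by simp
  moreover have "(p, ?e) \<in> right_pairs K P" using e p by (simp add: right_pairs_iff)
  ultimately show ?thesis
    using nu_comp[of p ?e ?e] e p nu_nonzero[of p ?e]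
    by (simp add: composable_pairs_def right_act_ident)
qed

text \<open>Twisting by \<open>\<mu>\<close> can be undone by a change of variables. In terms of the coordinate \<open>w = t z
\<mu>(h, p)\<close> in place of \<open>t\<close>, the map \<open>((t, h), (z, p)) \<mapsto> ((t, h)(z, p), (z, p))\<close> becomes the product
of the identity on the torus of pairs \<open>(w, z)\<close> with the map \<open>(h, p) \<mapsto> (h p, p)\<close>.\<close>

lemma twist_left_proper:
  "proper_map (left_pair_space gerbe_left twist)
    (prod_topology (point_space twist) (point_space twist)) (\<lambda>(a, q). (left_act twist a q, q))"
proof (rule proper_map_transfer)
  let ?C = "prod_topology circle_space circle_space"
  let ?a = "\<lambda>(b, q). ((fst b * fst q * \<mu> (snd b) (snd q), fst q), (snd b, snd q))"
  show "proper_map (prod_topology ?C (left_pair_space H P))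
      (prod_topology ?C (prod_topology (point_space P) (point_space P)))
      (\<lambda>(w, x). (w, case x of (h, p) \<Rightarrow> (left_act P h p, p)))"
    using left_proper proper_map_id[of ?C] unfolding proper_map_prod id_def by blast
  show "proper_map (left_pair_space gerbe_left twist) (prod_topology ?C (left_pair_space H P)) ?a"
  proof (rule proper_map_of_inverse)
    show "continuous_map (left_pair_space gerbe_left twist)
        (prod_topology ?C (left_pair_space H P)) ?a"
      unfolding split_beta left_pair_space_def gerbe_groupoid_select circle_bimodule_select
      by (rule continuous_components continuous_map_into_subtopology
          | force simp: left_pairs_circle_bimodule left_pairs_iff)+
    show "continuous_map (prod_topology ?C (left_pair_space H P))
        (left_pair_space gerbe_left twist)
        (\<lambda>(w, x). ((fst w * inverse (snd w) * inverse (\<mu> (fst x) (snd x)), fst x), (snd w, snd x)))"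
      unfolding split_beta left_pair_space_def gerbe_groupoid_select circle_bimodule_select
      by (rule continuous_components continuous_map_into_subtopology
          | force simp: left_pairs_circle_bimodule left_pairs_iff norm_mult norm_inverse norm_mu)+
  qed (auto simp: left_pair_space_def left_pairs_circle_bimodule mu_nonzero
      left_pairs_iff field_simps circle_nonzero)
  show "continuous_map (prod_topology (point_space twist) (point_space twist))
      (prod_topology ?C (prod_topology (point_space P) (point_space P)))
      (\<lambda>r. ((fst (fst r), fst (snd r)), (snd (fst r), snd (snd r))))"
    unfolding circle_bimodule_select by (rule continuous_components)+
qed (auto simp: inj_on_def left_pair_space_def left_pairs_circle_bimodule norm_mult norm_mu
    left_act_in_points left_pairs_iff)

lemma twist_right_proper:
  "proper_map (right_pair_space gerbe_right twist)
    (prod_topology (point_space twist) (point_space twist)) (\<lambda>(q, b). (q, right_act twist q b))"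
proof (rule proper_map_transfer)
  let ?C = "prod_topology circle_space circle_space"
  let ?a = "\<lambda>(q, b). ((fst q, fst q * fst b * \<nu> (snd q) (snd b)), (snd q, snd b))"
  show "proper_map (prod_topology ?C (right_pair_space K P))
      (prod_topology ?C (prod_topology (point_space P) (point_space P)))
      (\<lambda>(w, x). (w, case x of (p, k) \<Rightarrow> (p, right_act P p k)))"
    using right_proper proper_map_id[of ?C] unfolding proper_map_prod id_def by blast
  show "proper_map (right_pair_space gerbe_right twist) (prod_topology ?C (right_pair_space K P)) ?a"
  proof (rule proper_map_of_inverse)
    show "continuous_map (right_pair_space gerbe_right twist)
        (prod_topology ?C (right_pair_space K P)) ?a"
      unfolding split_beta right_pair_space_def gerbe_groupoid_select circle_bimodule_select
      by (rule continuous_components continuous_map_into_subtopology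
          | force simp: right_pairs_circle_bimodule right_pairs_iff)+
    show "continuous_map (prod_topology ?C (right_pair_space K P))
        (right_pair_space gerbe_right twist)
        (\<lambda>(w, x). ((fst w, fst x), (snd w * inverse (fst w) * inverse (\<nu> (fst x) (snd x)), snd x)))"
      unfolding split_beta right_pair_space_def gerbe_groupoid_select circle_bimodule_select
      by (rule continuous_components continuous_map_into_subtopology
          | force simp: right_pairs_circle_bimodule right_pairs_iff norm_mult norm_inverse norm_nu)+
  qed (auto simp: right_pair_space_def right_pairs_circle_bimodule nu_nonzero
      right_pairs_iff field_simps circle_nonzero)
  show "continuous_map (prod_topology (point_space twist) (point_space twist))
      (prod_topology ?C (prod_topology (point_space P) (point_space P)))
      (\<lambda>r. ((fst (fst r), fst (snd r)), (snd (fst r), snd (snd r))))"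
    unfolding circle_bimodule_select by (rule continuous_components)+
qed (auto simp: inj_on_def right_pair_space_def right_pairs_circle_bimodule norm_mult norm_nu
    right_act_in_points right_pairs_iff)

text \<open>The circle acts simply transitively on the first coordinate, so two points of the twist with
the same left moment are related by a unique lift of the arrow relating their second coordinates.\<close>

lemma twist_left_moment_homeomorphic:
  "homeomorphic_map (quotient_space (point_space twist) (right_orbits gerbe_right twist))
    (object_space gerbe_left) (\<lambda>c. the_elem (left_moment twist ` c))"
  unfolding right_orbits_def
proof (rule homeomorphic_map_orbit_spaceI)
  have "quotient_map (prod_topology circle_space (point_space P)) (point_space P) snd"
    by (simp add: circle_space_nontrivial)
  from quotient_map_compose[OF this quotient_map_left_moment]
  show "quotient_map (point_space twist) (object_space gerbe_left) (left_moment twist)"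
    by (simp add: o_def)
  show "(q, r) \<in> {(q, right_act twist q b) |q b. (q, b) \<in> right_pairs gerbe_right twist} \<longleftrightarrow>
      q \<in> points twist \<and> r \<in> points twist \<and> left_moment twist q = left_moment twist r" for q r
  proof
    assume "q \<in> points twist \<and> r \<in> points twist \<and> left_moment twist q = left_moment twist r"
    then have q: "norm (fst q) = 1" "norm (fst r) = 1" "snd q \<in> points P" "snd r \<in> points P"
      "left_moment P (snd q) = left_moment P (snd r)"
      by auto
    then obtain k where k: "(snd q, k) \<in> right_pairs K P" "right_act P (snd q) k = snd r"
      using left_moment_eqD by blast
    let ?b = "(fst r * inverse (fst q) * inverse (\<nu> (snd q) k), k)"
    have "(q, ?b) \<in> right_pairs gerbe_right twist"
      using q k by (simp add: right_pairs_circle_bimodule norm_mult norm_inverse norm_nu)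
    moreover have "fst q \<noteq> 0" using q(1) by force
    then have "right_act twist q ?b = r" using k nu_nonzero[OF k(1)] by (simp add: prod_eq_iff)
    ultimately show "(q, r) \<in> {(q, right_act twist q b) |q b. (q, b) \<in> right_pairs gerbe_right twist}"
      by force
  qed (auto simp: right_pairs_circle_bimodule right_pairs_iff norm_mult norm_nu right_act_in_points
      left_moment_right_act)
qed

lemma twist_right_moment_homeomorphic:
  "homeomorphic_map (quotient_space (point_space twist) (left_orbits gerbe_left twist))
    (object_space gerbe_right) (\<lambda>c. the_elem (right_moment twist ` c))"
  unfolding left_orbits_def
proof (rule homeomorphic_map_orbit_spaceI)
  have "quotient_map (prod_topology circle_space (point_space P)) (point_space P) snd"
    by (simp add: circle_space_nontrivial)
  from quotient_map_compose[OF this quotient_map_right_moment]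
  show "quotient_map (point_space twist) (object_space gerbe_right) (right_moment twist)"
    by (simp add: o_def)
  show "(q, r) \<in> {(q, left_act twist a q) |a q. (a, q) \<in> left_pairs gerbe_left twist} \<longleftrightarrow>
      q \<in> points twist \<and> r \<in> points twist \<and> right_moment twist q = right_moment twist r" for q r
  proof
    assume "q \<in> points twist \<and> r \<in> points twist \<and> right_moment twist q = right_moment twist r"
    then have q: "norm (fst q) = 1" "norm (fst r) = 1" "snd q \<in> points P" "snd r \<in> points P"
      "right_moment P (snd q) = right_moment P (snd r)"
      by auto
    then obtain h where h: "(h, snd q) \<in> left_pairs H P" "left_act P h (snd q) = snd r"
      using right_moment_eqD by blast
    let ?a = "(fst r * inverse (fst q) * inverse (\<mu> h (snd q)), h)"
    have "(?a, q) \<in> left_pairs gerbe_left twist"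
      using q h by (simp add: left_pairs_circle_bimodule norm_mult norm_inverse norm_mu)
    moreover have "fst q \<noteq> 0" using q(1) by force
    then have "left_act twist ?a q = r" using h mu_nonzero[OF h(1)] by (simp add: prod_eq_iff field_simps)
    ultimately show "(q, r) \<in> {(q, left_act twist a q) |a q. (a, q) \<in> left_pairs gerbe_left twist}"
      by force
  qed (auto simp: left_pairs_circle_bimodule left_pairs_iff norm_mult norm_mu left_act_in_points
      right_moment_left_act)
qed

theorem morita_bimodule_twist: "morita_bimodule gerbe_left gerbe_right twist"
proof -
  interpret L: topological_groupoid gerbe_left
    by (rule topological_groupoid_gerbe_groupoid)
      (use left.topological_groupoid_axioms continuous_psi psi_cocycle in auto)
  interpret R: topological_groupoid gerbe_right
    by (rule topological_groupoid_gerbe_groupoid)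
      (use right.topological_groupoid_axioms continuous_phi phi_cocycle in auto)
  show ?thesis
  proof
    show "continuous_map (point_space twist) (object_space gerbe_left) (left_moment twist)"
      "continuous_map (point_space twist) (object_space gerbe_right) (right_moment twist)"
      unfolding gerbe_groupoid_select circle_bimodule_select by (rule continuous_components)+
    show "continuous_map (left_pair_space gerbe_left twist) (point_space twist)
        (\<lambda>(a, q). left_act twist a q)"
      unfolding split_beta left_pair_space_def gerbe_groupoid_select circle_bimodule_select
      by (rule continuous_components | force simp: left_pairs_circle_bimodule left_pairs_iff)+
    show "continuous_map (right_pair_space gerbe_right twist) (point_space twist)
        (\<lambda>(q, b). right_act twist q b)"
      unfolding split_beta right_pair_space_def gerbe_groupoid_select circle_bimodule_select
      by (rule continuous_components | force simp: right_pairs_circle_bimodule right_pairs_iff)+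
  next
    fix a b q
    assume "(a, b) \<in> composable_pairs gerbe_left" "(b, q) \<in> left_pairs gerbe_left twist"
    then show "left_act twist (arrow_comp gerbe_left a b) q = left_act twist a (left_act twist b q)"
      using mu_comp[of "snd a" "snd b" "snd q"] left_act_comp[of "snd a" "snd b" "snd q"]
      by (simp add: composable_pairs_gerbe_groupoid left_pairs_circle_bimodule mult_ac)
  next
    fix q a b
    assume "(a, b) \<in> composable_pairs gerbe_right" "(q, a) \<in> right_pairs gerbe_right twist"
    then show "right_act twist q (arrow_comp gerbe_right a b) = right_act twist (right_act twist q a) b"
      using nu_comp[of "snd q" "snd a" "snd b"] right_act_comp[of "snd q" "snd a" "snd b"]
      by (simp add: composable_pairs_gerbe_groupoid right_pairs_circle_bimodule mult_ac)
  next
    fix a q b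
    assume "(a, q) \<in> left_pairs gerbe_left twist" "(q, b) \<in> right_pairs gerbe_right twist"
    then show "right_act twist (left_act twist a q) b = left_act twist a (right_act twist q b)"
      using mu_nu_commute[of "snd a" "snd q" "snd b"] acts_commute[of "snd a" "snd q" "snd b"]
      by (simp add: left_pairs_circle_bimodule right_pairs_circle_bimodule mult_ac)
  next
    fix a q assume a: "(a, q) \<in> left_pairs gerbe_left twist" "left_act twist a q = q"
    then have p: "(snd a, snd q) \<in> left_pairs H P" and nz: "fst q \<noteq> 0"
      by (auto simp: left_pairs_circle_bimodule)
    have s: "snd a = ident H (left_moment P (snd q))"
      using left_free[OF p] a(2) by (simp add: prod_eq_iff)
    have "fst a * fst q * \<mu> (snd a) (snd q) = fst q" using a(2) by (simp add: prod_eq_iff)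
    then have "fst a * \<mu> (snd a) (snd q) = 1" using nz by (simp add: field_simps)
    then have "fst a = inverse (\<mu> (snd a) (snd q))" using inverse_unique mult.commute by metis
    then show "a = ident gerbe_left (left_moment twist q)"
      using s p mu_ident by (simp add: prod_eq_iff left_pairs_iff)
  next
    fix q b assume b: "(q, b) \<in> right_pairs gerbe_right twist" "right_act twist q b = q"
    then have p: "(snd q, snd b) \<in> right_pairs K P" and nz: "fst q \<noteq> 0"
      by (auto simp: right_pairs_circle_bimodule)
    have s: "snd b = ident K (right_moment P (snd q))"
      using right_free[OF p] b(2) by (simp add: prod_eq_iff)
    have "fst q * fst b * \<nu> (snd q) (snd b) = fst q" using b(2) by (simp add: prod_eq_iff)
    then have "fst b * \<nu> (snd q) (snd b) = 1" using nz by (simp add: field_simps)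
    then have "fst b = inverse (\<nu> (snd q) (snd b))" using inverse_unique mult.commute by metis
    then show "b = ident gerbe_right (right_moment twist q)"
      using s p nu_ident by (simp add: prod_eq_iff right_pairs_iff)
  next
    fix q assume q: "q \<in> points twist"
    then have p: "snd q \<in> points P" by auto
    have "\<mu> (ident H (left_moment P (snd q))) (snd q) \<noteq> 0"
      using p by (intro mu_nonzero) (simp add: left_pairs_iff left_moment_in_objects
          left.ident_in_arrows left.src_ident)
    then show "left_act twist (ident gerbe_left (left_moment twist q)) q = q"
      using p by (simp add: mu_ident[symmetric] left_act_ident prod_eq_iff)
    have "\<nu> (snd q) (ident K (right_moment P (snd q))) \<noteq> 0"
      using p by (intro nu_nonzero) (simp add: right_pairs_iff right_moment_in_objects
          right.ident_in_arrows right.rng_ident)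
    then show "right_act twist q (ident gerbe_right (right_moment twist q)) = q"
      using p by (simp add: nu_ident[symmetric] right_act_ident prod_eq_iff)
  qed (rule twist_left_proper twist_right_proper twist_left_moment_homeomorphic
      twist_right_moment_homeomorphic
    | simp add: left_pairs_circle_bimodule right_pairs_circle_bimodule left_moment_left_act
      right_moment_right_act right_moment_left_act left_moment_right_act)+
qed

end

lemma cohomologous_along_imp_morita_gerbes:
  fixes H :: "('h, 'u, 'x) groupoid_scheme" and K :: "('k, 'v, 'y) groupoid_scheme"
    and P :: "('p, 'h, 'k, 'u, 'v, 'z) bimodule_scheme"
  assumes "morita_bimodule H K P" and "cohomologous_along H K P \<psi> \<phi>"
    and "continuous_map (composable_space H) circle_space (\<lambda>(x, y). \<psi> x y)"
    and "continuous_map (composable_space K) circle_space (\<lambda>(x, y). \<phi> x y)"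
  shows "\<exists>Q :: (complex \<times> 'p, complex \<times> 'h, complex \<times> 'k, 'u, 'v) bimodule.
    morita_bimodule (gerbe_groupoid H \<psi>) (gerbe_groupoid K \<phi>) Q"
proof -
  obtain \<mu> \<nu> where "twisted_morita_bimodule_axioms H K P \<psi> \<phi> \<mu> \<nu>"
    using assms(2-4) unfolding cohomologous_along_def twisted_morita_bimodule_axioms_def by blast
  then have "twisted_morita_bimodule H K P \<psi> \<phi> \<mu> \<nu>"
    using assms(1) by (simp add: twisted_morita_bimodule_def)
  then show ?thesis using twisted_morita_bimodule.morita_bimodule_twist by blast
qed


section \<open>The twisted groupoid inside the bundle groupoid\<close>

text \<open>The map \<open>(n, x) \<mapsto> n \<rho>(x)\<close> is the homomorphism from \<open>N \<rtimes> H\<close> to \<open>G\<close> that \<open>\<rho>\<close> itself may fail to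
be; the twist in the product of \<open>N \<rtimes> H\<close> is designed for this (see \<open>holonomy_comp\<close>). It measures
how an arrow of \<open>G \<rtimes> N \<rtimes> H\<close> moves the \<open>G\<close>-coordinate.\<close>

definition holonomy :: "('g, 'm) monoid_scheme \<Rightarrow> ('a \<Rightarrow> 'g) \<Rightarrow> 'g \<times> 'a \<Rightarrow> 'g"
  where "holonomy G \<rho> a = fst a \<otimes>\<^bsub>G\<^esub> \<rho> (snd a)"

lemma twisted_groupoid_select [simp]:
  "arrow_space (twisted_groupoid G T N H \<rho>) = prod_topology (subtopology T N) (arrow_space H)"
  "object_space (twisted_groupoid G T N H \<rho>) = object_space H"
  "src (twisted_groupoid G T N H \<rho>) = (\<lambda>a. src H (snd a))"
  "rng (twisted_groupoid G T N H \<rho>) = (\<lambda>a. rng H (snd a))"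
  by (auto simp: twisted_groupoid_def split_beta fun_eq_iff)

lemma bundle_groupoid_select [simp]:
  "arrow_space (bundle_groupoid G T N H \<rho>) =
    prod_topology T (prod_topology (subtopology T N) (arrow_space H))"
  "object_space (bundle_groupoid G T N H \<rho>) = prod_topology T (object_space H)"
  "rng (bundle_groupoid G T N H \<rho>) = (\<lambda>b. (fst b, rng H (snd (snd b))))"
  "arrow_comp (bundle_groupoid G T N H \<rho>) =
    (\<lambda>b c. (fst b, arrow_comp (twisted_groupoid G T N H \<rho>) (snd b) (snd c)))"
  "ident (bundle_groupoid G T N H \<rho>) = (\<lambda>u. (fst u, ident (twisted_groupoid G T N H \<rho>) (snd u)))"
  "arrow_act (bundle_groupoid G T N H \<rho>) = (\<lambda>g b. (g \<otimes>\<^bsub>G\<^esub> fst b, snd b))"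
  "object_act (bundle_groupoid G T N H \<rho>) = (\<lambda>g u. (g \<otimes>\<^bsub>G\<^esub> fst u, snd u))"
  by (auto simp: bundle_groupoid_def split_beta fun_eq_iff)

lemma crossed_groupoid_select [simp]:
  "arrow_space (crossed_groupoid G T L) = prod_topology T (arrow_space L)"
  "src (crossed_groupoid G T L) = (\<lambda>c. src L (arrow_act L (inv\<^bsub>G\<^esub> (fst c)) (snd c)))"
  "rng (crossed_groupoid G T L) = (\<lambda>c. rng L (snd c))"
  "arrow_comp (crossed_groupoid G T L) =
    (\<lambda>c d. (fst c \<otimes>\<^bsub>G\<^esub> fst d, arrow_comp L (snd c) (arrow_act L (fst c) (snd d))))"
  by (auto simp: crossed_groupoid_def split_beta fun_eq_iff)

lemma crossed_bimodule_select [simp]: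
  "point_space (crossed_bimodule G T K P) = prod_topology T (point_space P)"
  "left_moment (crossed_bimodule G T K P) = (\<lambda>q. left_moment P (snd q))"
  "right_moment (crossed_bimodule G T K P) =
    (\<lambda>q. object_act K (inv\<^bsub>G\<^esub> (fst q)) (right_moment P (snd q)))"
  "left_act (crossed_bimodule G T K P) =
    (\<lambda>c q. (fst c \<otimes>\<^bsub>G\<^esub> fst q, left_act P (snd c) (point_act P (fst c) (snd q))))"
  "right_act (crossed_bimodule G T K P) =
    (\<lambda>q c. (fst q \<otimes>\<^bsub>G\<^esub> fst c, right_act P (snd q) (arrow_act K (fst q) (snd c))))"
  by (auto simp: crossed_bimodule_def split_beta fun_eq_iff)

locale principal_bundle = locally_compact_group G T
  for G :: "('g, 'm) monoid_scheme" (structure) and T :: "'g topology" +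
  fixes N :: "'g set" and H :: "('a, 'o, 'z) groupoid_scheme" and \<rho> :: "'a \<Rightarrow> 'g"
  assumes N_subset: "N \<subseteq> carrier G"
    and continuous_lift: "continuous_map (arrow_space H) T \<rho>"
    and bundle_groupoid: "topological_groupoid (bundle_groupoid G T N H \<rho>)"
begin

sublocale total: topological_groupoid "bundle_groupoid G T N H \<rho>"
  by (rule bundle_groupoid)

abbreviation "B \<equiv> bundle_groupoid G T N H \<rho>"
abbreviation "W \<equiv> twisted_groupoid G T N H \<rho>"
abbreviation "hol \<equiv> holonomy G \<rho>"

lemma lift_closed [simp]: "x \<in> arrows H \<Longrightarrow> \<rho> x \<in> carrier G"
  using continuous_map_funspace[OF continuous_lift] by (auto simp: topspace_eq)

lemma arrows_twisted: "a \<in> arrows W \<longleftrightarrow> fst a \<in> N \<and> snd a \<in> arrows H"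
  using N_subset by (cases a) (auto simp: topspace_eq)

lemma arrows_bundle: "b \<in> arrows B \<longleftrightarrow> fst b \<in> carrier G \<and> snd b \<in> arrows W"
  by (cases b) (auto simp: topspace_eq)

lemma holonomy_closed [simp]: "a \<in> arrows W \<Longrightarrow> hol a \<in> carrier G"
  using N_subset unfolding arrows_twisted holonomy_def by auto

lemma src_bundle: "b \<in> arrows B \<Longrightarrow> src B b = (fst b \<otimes> hol (snd b), src H (snd (snd b)))"
  using N_subset unfolding arrows_bundle arrows_twisted
  by (auto simp: bundle_groupoid_def split_beta holonomy_def m_assoc subsetD)

lemma inverse_arrow_bundle:
  "b \<in> arrows B \<Longrightarrow> inverse_arrow B b = (fst b \<otimes> hol (snd b), inverse_arrow W (snd b))"
  using N_subset unfolding arrows_bundle arrows_twisted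
  by (auto simp: bundle_groupoid_def split_beta holonomy_def m_assoc subsetD)

lemma composable_twisted: "(a, b) \<in> composable_pairs W \<longleftrightarrow>
    a \<in> arrows W \<and> b \<in> arrows W \<and> src H (snd a) = rng H (snd b)"
  by (simp add: composable_pairs_def)

lemma composable_bundle: "(b, c) \<in> composable_pairs B \<longleftrightarrow>
    b \<in> arrows B \<and> fst c = fst b \<otimes> hol (snd b) \<and> (snd b, snd c) \<in> composable_pairs W"
  by (auto simp: composable_pairs_def src_bundle arrows_bundle simp del: bundle_groupoid_select(1)
      twisted_groupoid_select(1))

lemma composable_bundleI: "\<lbrakk>(a, b) \<in> composable_pairs W; g \<in> carrier G; g' = g \<otimes> hol a\<rbrakk>
    \<Longrightarrow> ((g, a), (g', b)) \<in> composable_pairs B"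
  by (simp add: composable_bundle arrows_bundle composable_twisted
      del: bundle_groupoid_select(1) twisted_groupoid_select(1))

lemma holonomy_comp:
  assumes "(a, b) \<in> composable_pairs W"
  shows "hol (arrow_comp W a b) = hol a \<otimes> hol b"
proof -
  have "arrow_comp B (\<one>, a) (hol a, b) \<in> arrows B"
    using assms by (intro total.comp_in_arrows composable_bundleI)
      (auto simp: composable_twisted simp del: twisted_groupoid_select(1))
  then have "arrow_comp W a b \<in> arrows W"
    by (simp add: arrows_bundle del: bundle_groupoid_select(1) twisted_groupoid_select(1))
  moreover have "snd (arrow_comp W a b) = arrow_comp H (snd a) (snd b)"
    by (simp add: twisted_groupoid_def split_beta)
  ultimately have "arrow_comp H (snd a) (snd b) \<in> arrows H" unfolding arrows_twisted by simp
  then have closed: "fst a \<in> carrier G" "fst b \<in> carrier G" "\<rho> (snd a) \<in> carrier G"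
      "\<rho> (snd b) \<in> carrier G" "\<rho> (arrow_comp H (snd a) (snd b)) \<in> carrier G"
    using assms N_subset unfolding composable_twisted arrows_twisted by auto
  have cancel: "inv x \<otimes> (x \<otimes> y) = y" if "x \<in> carrier G" "y \<in> carrier G" for x y
    using that by (simp flip: m_assoc)
  show ?thesis
    using closed by (simp add: holonomy_def twisted_groupoid_def split_beta lift_defect_def m_assoc
        cancel)
qed

lemma continuous_holonomy:
  assumes "continuous_map Z (arrow_space W) f"
  shows "continuous_map Z T (\<lambda>z. hol (f z))"
proof -
  have f: "continuous_map Z (prod_topology (subtopology T N) (arrow_space H)) f"
    using assms by simp
  have "continuous_map Z T (\<lambda>z. fst (f z))"
    by (rule continuous_map_into_fulltopology[OF continuous_map_fst_pointwise[OF f]])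
  moreover have "continuous_map Z T (\<lambda>z. \<rho> (snd (f z)))"
    by (rule continuous_map_compose_pointwise[OF continuous_map_snd_pointwise[OF f] continuous_lift])
  ultimately show ?thesis unfolding holonomy_def
    by (rule continuous_map_compose_binary_total[OF continuous_mult])
qed

text \<open>Sending \<open>(g, a)\<close> to \<open>a\<close> is a homomorphism from the bundle groupoid to the twisted groupoid,
and every composable string \<open>a, b, c\<close> lifts uniquely to one that begins over the identity, namely
\<open>(1, a), (hol a, b), (hol a hol b, c)\<close>. So each axiom is the image of the same axiom upstairs, and
the structure maps are continuous because the lift is.\<close>

lemma topological_groupoid_twisted: "topological_groupoid W"
proof -
  note [simp del] = bundle_groupoid_select(1) twisted_groupoid_select(1)
  note arr = arrows_bundle src_bundle inverse_arrow_bundle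
  have W_space: "arrow_space B = prod_topology T (arrow_space W)"
    by (simp add: bundle_groupoid_select(1) twisted_groupoid_select(1))
  have one: "continuous_map Z T (\<lambda>z. \<one>)" for Z :: "'w topology"
    by (simp add: topspace_eq)
  have emb: "continuous_map (arrow_space W) (arrow_space B) (\<lambda>a. (\<one>, a))"
    unfolding W_space by (intro continuous_map_pair_intros one)
  have obj: "continuous_map (object_space W) (object_space B) (\<lambda>u. (\<one>, u))"
    unfolding bundle_groupoid_select twisted_groupoid_select
    by (intro continuous_map_pairedI one continuous_map_identity)
  have proj: "continuous_map Z (arrow_space W) (\<lambda>z. snd (f z))"
    if "continuous_map Z (arrow_space B) f" for Z :: "'w topology" and f
    using that unfolding W_space by (rule continuous_map_snd_pointwise)
  have proj_obj: "continuous_map Z (object_space W) (\<lambda>z. snd (f z))"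
    if "continuous_map Z (object_space B) f" for Z :: "'w topology" and f
    using that by (simp add: continuous_map_snd_pointwise)
  show ?thesis
  proof
    show "continuous_map (arrow_space W) (object_space W) (src W)"
      using proj_obj[OF continuous_map_compose_pointwise[OF emb total.continuous_src]]
      by (rule continuous_map_eq) (simp add: arr)
    show "continuous_map (arrow_space W) (object_space W) (rng W)"
      using proj_obj[OF continuous_map_compose_pointwise[OF emb total.continuous_rng]] by simp
    show "continuous_map (object_space W) (arrow_space W) (ident W)"
      using proj[OF continuous_map_compose_pointwise[OF obj total.continuous_ident]] by simp
    show "continuous_map (arrow_space W) (arrow_space W) (inverse_arrow W)"
      using proj[OF continuous_map_compose_pointwise[OF emb total.continuous_inverse]]
      by (rule continuous_map_eq) (simp add: arr)
    have "continuous_map (composable_space W) (arrow_space B)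
        (\<lambda>z. arrow_comp B (\<one>, fst z) (hol (fst z), snd z))"
    proof (rule continuous_map_compose_binary[OF total.continuous_comp[unfolded composable_space_def]])
      have a: "continuous_map (composable_space W) (arrow_space W) fst"
        and b: "continuous_map (composable_space W) (arrow_space W) snd"
        unfolding composable_space_def
        by (simp_all add: continuous_map_from_subtopology continuous_map_fst continuous_map_snd)
      show "continuous_map (composable_space W) (arrow_space B) (\<lambda>z. (\<one>, fst z))"
        unfolding W_space by (intro continuous_map_pairedI one a)
      show "continuous_map (composable_space W) (arrow_space B) (\<lambda>z. (hol (fst z), snd z))"
        unfolding W_space by (intro continuous_map_pairedI continuous_holonomy a b)
    qed (auto simp: topspace_composable_space composable_twisted intro!: composable_bundleI)
    from proj[OF this] show "continuous_map (composable_space W) (arrow_space W)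
        (\<lambda>(x, y). arrow_comp W x y)" by (simp add: case_prod_unfold)
  next
    fix a b assume ab: "(a, b) \<in> composable_pairs W"
    then have "((\<one>, a), (hol a, b)) \<in> composable_pairs B"
      by (intro composable_bundleI) (auto simp: composable_twisted)
    note c = this total.comp_in_arrows[OF this]
    show "src W (arrow_comp W a b) = src W b" "rng W (arrow_comp W a b) = rng W a"
      using total.src_comp[OF c(1)] total.rng_comp[OF c(1)] c ab
      by (auto simp: arr composable_twisted)
    fix d assume bd: "(b, d) \<in> composable_pairs W"
    then have "((hol a, b), (hol a \<otimes> hol b, d)) \<in> composable_pairs B"
      using ab by (intro composable_bundleI) (auto simp: composable_twisted)
    from total.comp_assoc[OF c(1) this]
    show "arrow_comp W (arrow_comp W a b) d = arrow_comp W a (arrow_comp W b d)" by simp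
  next
    fix u assume u: "u \<in> objects W"
    then have "(\<one>, u) \<in> objects B" by (simp add: topspace_eq)
    then show "src W (ident W u) = u" "rng W (ident W u) = u"
      using total.src_ident[of "(\<one>, u)"] total.rng_ident[of "(\<one>, u)"]
        total.ident_in_arrows[of "(\<one>, u)"] by (auto simp: arr)
  next
    fix a assume a: "a \<in> arrows W"
    then have b: "(\<one>, a) \<in> arrows B" by (simp add: arr)
    show "arrow_comp W (ident W (rng W a)) a = a" "arrow_comp W a (ident W (src W a)) = a"
      "src W (inverse_arrow W a) = rng W a" "rng W (inverse_arrow W a) = src W a"
      "arrow_comp W (inverse_arrow W a) a = ident W (src W a)"
      "arrow_comp W a (inverse_arrow W a) = ident W (rng W a)"
      using total.ident_comp[OF b] total.comp_ident[OF b] total.src_inverse[OF b]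
        total.rng_inverse[OF b] total.inverse_comp[OF b] total.comp_inverse[OF b]
        total.inverse_in_arrows[OF b] b a
      by (auto simp: arr)
  qed
qed

lemma dual_inclusion_eq: "dual_inclusion G \<rho> a = (hol a, \<one>, a)"
  by (simp add: dual_inclusion_def split_beta holonomy_def)

text \<open>With the next lemma, this says that \<open>\<iota>\<close> is a homomorphism to \<open>G \<ltimes> (G \<rtimes> N \<rtimes> H)\<close>.\<close>

lemma dual_inclusion_composable:
  assumes "(a, b) \<in> composable_pairs W"
  shows "(dual_inclusion G \<rho> a, dual_inclusion G \<rho> b) \<in> composable_pairs (crossed_groupoid G T B)"
  using assms
  by (simp add: composable_pairs_def[of "crossed_groupoid G T B"] dual_inclusion_eq arrows_bundle
      src_bundle composable_twisted topspace_eq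
      del: bundle_groupoid_select(1) twisted_groupoid_select(1))

lemma dual_inclusion_comp:
  assumes "(a, b) \<in> composable_pairs W"
  shows "arrow_comp (crossed_groupoid G T B) (dual_inclusion G \<rho> a) (dual_inclusion G \<rho> b)
    = dual_inclusion G \<rho> (arrow_comp W a b)"
  by (simp add: dual_inclusion_eq holonomy_comp[OF assms])

lemma continuous_dual_cocycle:
  assumes "equivariant_2cocycle G T B \<sigma> lam \<beta>"
  shows "continuous_map (composable_space W) circle_space
    (\<lambda>(a, b). dual_cocycle G \<rho> (crossed_cocycle B \<sigma> lam \<beta>) a b)"
proof -
  note [simp del] = bundle_groupoid_select(1) twisted_groupoid_select(1)
  let ?Z = "composable_space W"
  have B_space: "arrow_space B = prod_topology T (arrow_space W)"
    by (simp add: bundle_groupoid_select(1) twisted_groupoid_select(1))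
  have \<sigma>: "continuous_map (composable_space B) circle_space (\<lambda>(x, y). \<sigma> x y)"
    and lam: "continuous_map (prod_topology T (arrow_space B)) circle_space (\<lambda>(g, x). lam g x)"
    and \<beta>: "continuous_map (prod_topology T (prod_topology T (object_space B))) circle_space
      (\<lambda>(g, h, u). \<beta> g h u)"
    using assms unfolding equivariant_2cocycle_def by blast+
  have one: "continuous_map ?Z T (\<lambda>z. \<one>)" by (simp add: topspace_eq)
  have a: "continuous_map ?Z (arrow_space W) fst" and b: "continuous_map ?Z (arrow_space W) snd"
    unfolding composable_space_def
    by (simp_all add: continuous_map_from_subtopology continuous_map_fst continuous_map_snd)
  note ha = continuous_holonomy[OF a] and hb = continuous_holonomy[OF b]
  have x: "continuous_map ?Z (arrow_space B) (\<lambda>z. (\<one>, fst z))"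
    and y: "continuous_map ?Z (arrow_space B) (\<lambda>z. (hol (fst z), snd z))"
    unfolding B_space by (intro continuous_map_pairedI one ha a b)+
  have c1: "continuous_map ?Z circle_space (\<lambda>z. \<sigma> (\<one>, fst z) (hol (fst z), snd z))"
    by (rule continuous_map_compose_binary[OF \<sigma>[unfolded composable_space_def] x y])
      (auto simp: topspace_composable_space composable_twisted intro!: composable_bundleI)
  have c2: "continuous_map ?Z circle_space (\<lambda>z. lam (hol (fst z)) (hol (fst z), snd z))"
    by (rule continuous_map_compose_binary_total[OF lam ha y])
  have "continuous_map ?Z (prod_topology T (prod_topology T (object_space B)))
      (\<lambda>z. (hol (fst z), hol (snd z), src B (hol (fst z), snd z)))"
    by (intro continuous_map_pairedI ha hb continuous_map_compose_pointwise[OF y total.continuous_src])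
  from continuous_map_compose_pointwise[OF this \<beta>]
  have c3: "continuous_map ?Z circle_space
      (\<lambda>z. \<beta> (hol (fst z)) (hol (snd z)) (src B (hol (fst z), snd z)))" by simp
  show ?thesis
    using continuous_map_circle_mult[OF continuous_map_circle_mult[OF c1 c2] c3]
    by (rule continuous_map_eq)
      (auto simp: dual_cocycle_def crossed_cocycle_def dual_inclusion_eq topspace_composable_space
        composable_twisted)
qed

end


section \<open>The identity slice of an equivariant bimodule\<close>

text \<open>The restriction of the bimodule \<open>G \<times> R\<close> of the crossed groupoids to the objects over the
identity of \<open>G\<close>. Its points are the \<open>(g, p)\<close> with \<open>p\<close> as below and \<open>g\<close> the \<open>G\<close>-coordinate of the
right moment of \<open>p\<close>; only \<open>p\<close> is recorded. The actions are those of \<open>\<iota>(n, x)\<close> and \<open>\<iota>(n, y)\<close>.\<close>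

definition identity_slice ::
  "('g, 'm) monoid_scheme \<Rightarrow> ('a \<Rightarrow> 'g)
    \<Rightarrow> ('g, 'p, 'g \<times> 'g \<times> 'a, 'g \<times> 'g \<times> 'b, 'g \<times> 'u, 'g \<times> 'v, 'z) G_bimodule_scheme
    \<Rightarrow> ('p, 'g \<times> 'a, 'g \<times> 'b, 'u, 'v) bimodule"
  where "identity_slice G \<rho> R =
    \<lparr>point_space = subtopology (point_space R) {p. fst (left_moment R p) = \<one>\<^bsub>G\<^esub>},
     left_moment = (\<lambda>p. snd (left_moment R p)),
     right_moment = (\<lambda>p. snd (right_moment R p)),
     left_act = (\<lambda>a p. left_act R (\<one>\<^bsub>G\<^esub>, a) (point_act R (holonomy G \<rho> a) p)),
     right_act = (\<lambda>p b. right_act R p (fst (right_moment R p), b))\<rparr>"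

lemma identity_slice_select [simp]:
  "point_space (identity_slice G \<rho> R) =
    subtopology (point_space R) {p. fst (left_moment R p) = \<one>\<^bsub>G\<^esub>}"
  "left_moment (identity_slice G \<rho> R) = (\<lambda>p. snd (left_moment R p))"
  "right_moment (identity_slice G \<rho> R) = (\<lambda>p. snd (right_moment R p))"
  "left_act (identity_slice G \<rho> R) =
    (\<lambda>a p. left_act R (\<one>\<^bsub>G\<^esub>, a) (point_act R (holonomy G \<rho> a) p))"
  "right_act (identity_slice G \<rho> R) = (\<lambda>p b. right_act R p (fst (right_moment R p), b))"
  by (simp_all add: identity_slice_def)

locale equivariant_bundle_bimodule =
  bundle1: principal_bundle G T N H1 \<rho>1 + bundle2: principal_bundle G T N H2 \<rho>2 +
  equivariant_morita_bimodule G T "bundle_groupoid G T N H1 \<rho>1" "bundle_groupoid G T N H2 \<rho>2" R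
  for G :: "('g, 'm) monoid_scheme" (structure) and T :: "'g topology" and N :: "'g set"
    and H1 :: "('a, 'u, 'x) groupoid_scheme" and \<rho>1 :: "'a \<Rightarrow> 'g"
    and H2 :: "('b, 'v, 'y) groupoid_scheme" and \<rho>2 :: "'b \<Rightarrow> 'g"
    and R :: "('g, 'p, 'g \<times> 'g \<times> 'a, 'g \<times> 'g \<times> 'b, 'g \<times> 'u, 'g \<times> 'v, 'z) G_bimodule_scheme"
begin

declare bundle_groupoid_select(1) [simp del] twisted_groupoid_select(1) [simp del]

abbreviation "L1 \<equiv> bundle_groupoid G T N H1 \<rho>1"
abbreviation "L2 \<equiv> bundle_groupoid G T N H2 \<rho>2"
abbreviation "W1 \<equiv> twisted_groupoid G T N H1 \<rho>1"
abbreviation "W2 \<equiv> twisted_groupoid G T N H2 \<rho>2"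
abbreviation "hol1 \<equiv> holonomy G \<rho>1"
abbreviation "hol2 \<equiv> holonomy G \<rho>2"
abbreviation "S \<equiv> identity_slice G \<rho>1 R"
abbreviation "left_coord p \<equiv> fst (left_moment R p)"
abbreviation "right_coord p \<equiv> fst (right_moment R p)"

lemma left_coord_closed [simp]: "p \<in> points R \<Longrightarrow> left_coord p \<in> carrier G"
  and right_coord_closed [simp]: "p \<in> points R \<Longrightarrow> right_coord p \<in> carrier G"
  using left_moment_in_objects right_moment_in_objects
  by (auto simp: bundle1.topspace_eq mem_Times_iff)

lemma point_act_in_points [simp]:
  "\<lbrakk>g \<in> carrier G; p \<in> points R\<rbrakk> \<Longrightarrow> point_act R g p \<in> points R"
  using continuous_map_funspace[OF point_action.continuous_act]
  by (auto simp: bundle1.topspace_eq dest: funcset_mem)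

lemma left_moment_point_act [simp]: "\<lbrakk>g \<in> carrier G; p \<in> points R\<rbrakk>
    \<Longrightarrow> left_moment R (point_act R g p) = (g \<otimes> left_coord p, snd (left_moment R p))"
  and right_moment_point_act [simp]: "\<lbrakk>g \<in> carrier G; p \<in> points R\<rbrakk>
    \<Longrightarrow> right_moment R (point_act R g p) = (g \<otimes> right_coord p, snd (right_moment R p))"
  by (simp_all add: left_moment_act right_moment_act)

lemma point_act_inverse: "\<lbrakk>g \<in> carrier G; p \<in> points R\<rbrakk>
    \<Longrightarrow> point_act R (inv g) (point_act R g p) = p \<and> point_act R g (point_act R (inv g) p) = p"
  by (simp flip: point_action.act_mult add: point_action.act_one)

lemma points_slice: "p \<in> points S \<longleftrightarrow> p \<in> points R \<and> left_coord p = \<one>"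
  by auto

lemma left_pairs_bundle: "(h, p) \<in> left_pairs L1 R \<longleftrightarrow> fst h \<in> carrier G \<and> snd h \<in> arrows W1 \<and>
    p \<in> points R \<and> left_moment R p = (fst h \<otimes> hol1 (snd h), src H1 (snd (snd h)))"
  using bundle1.src_bundle[of h] by (auto simp: left_pairs_iff bundle1.arrows_bundle)

lemma right_pairs_bundle: "(p, k) \<in> right_pairs L2 R \<longleftrightarrow> snd k \<in> arrows W2 \<and>
    p \<in> points R \<and> right_moment R p = (fst k, rng H2 (snd (snd k)))"
proof -
  have "fst k \<in> carrier G" if "right_moment R p = (fst k, v)" "p \<in> points R" for v
    using right_coord_closed[OF that(2)] that(1) by (metis fst_conv)
  then show ?thesis by (auto simp: right_pairs_iff bundle2.arrows_bundle)
qed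

lemma left_pairs_slice: "(a, p) \<in> left_pairs W1 S \<longleftrightarrow>
    a \<in> arrows W1 \<and> p \<in> points R \<and> left_moment R p = (\<one>, src H1 (snd a))"
  by (auto simp: left_pairs_def points_slice prod_eq_iff simp del: identity_slice_select(1))

lemma right_pairs_slice: "(p, b) \<in> right_pairs W2 S \<longleftrightarrow> b \<in> arrows W2 \<and> p \<in> points R \<and>
    left_coord p = \<one> \<and> snd (right_moment R p) = rng H2 (snd b)"
  by (auto simp: right_pairs_def points_slice simp del: identity_slice_select(1))

text \<open>The defining topology on the pairs for the slice restricts the points twice, once to the
slice and once to the pairs; the first restriction is implied by the second.\<close>

lemma left_pair_space_slice:
  "left_pair_space W1 S =
    subtopology (prod_topology (arrow_space W1) (point_space R)) (left_pairs W1 S)"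
proof -
  have "(arrows W1 \<times> {p. left_coord p = \<one>}) \<inter> left_pairs W1 S = left_pairs W1 S"
    by (auto simp: left_pairs_slice)
  then show ?thesis
    by (simp add: left_pair_space_def prod_topology_subtopology(2) subtopology_subtopology)
qed

lemma right_pair_space_slice:
  "right_pair_space W2 S =
    subtopology (prod_topology (point_space R) (arrow_space W2)) (right_pairs W2 S)"
proof -
  have "({p. left_coord p = \<one>} \<times> arrows W2) \<inter> right_pairs W2 S = right_pairs W2 S"
    by (auto simp: right_pairs_slice)
  then show ?thesis
    by (simp add: right_pair_space_def prod_topology_subtopology(1) subtopology_subtopology)
qed

lemma left_pairs_slice_lift:
  "(a, p) \<in> left_pairs W1 S \<Longrightarrow> ((\<one>, a), point_act R (hol1 a) p) \<in> left_pairs L1 R"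
  by (simp add: left_pairs_slice left_pairs_bundle)

lemma right_pairs_slice_lift:
  "(p, b) \<in> right_pairs W2 S \<Longrightarrow> (p, (right_coord p, b)) \<in> right_pairs L2 R"
  by (simp add: right_pairs_slice right_pairs_bundle prod_eq_iff)

lemma slice_left_act:
  assumes "(a, p) \<in> left_pairs W1 S"
  shows "left_act S a p \<in> points R"
    and "left_moment R (left_act S a p) = (\<one>, rng H1 (snd a))"
    and "right_moment R (left_act S a p) = (hol1 a \<otimes> right_coord p, snd (right_moment R p))"
  using left_pairs_slice_lift[OF assms] assms
  by (simp_all add: left_act_in_points left_moment_left_act right_moment_left_act left_pairs_slice)

lemma slice_right_act:
  assumes "(p, b) \<in> right_pairs W2 S"
  shows "right_act S p b \<in> points R"
    and "left_moment R (right_act S p b) = left_moment R p"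
    and "right_moment R (right_act S p b) = (right_coord p \<otimes> hol2 b, src H2 (snd b))"
  using right_pairs_slice_lift[OF assms] assms
  by (simp_all add: right_act_in_points left_moment_right_act right_moment_right_act
      right_pairs_slice bundle2.src_bundle bundle2.arrows_bundle)

text \<open>Equivariance is assumed for the two-sided products \<open>h p k\<close>. One-sided equivariance is the
case in which \<open>k\<close> is a unit, as \<open>G\<close> maps units to units.\<close>

lemma point_act_left_act:
  assumes g: "g \<in> carrier G" and hp: "(h, p) \<in> left_pairs L1 R"
  shows "point_act R g (left_act R h p) = left_act R (g \<otimes> fst h, snd h) (point_act R g p)"
proof -
  have p: "p \<in> points R" using hp by (simp add: left_pairs_bundle)
  let ?k = "ident L2 (right_moment R p)"
  have "(p, ?k) \<in> right_pairs L2 R" using p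
    by (simp add: right_pairs_iff right_moment_in_objects bundle2.total.ident_in_arrows
        bundle2.total.rng_ident
        del: bundle_groupoid_select)
  then have eq: "point_act R g (right_act R (left_act R h p) ?k)
      = right_act R (left_act R (g \<otimes> fst h, snd h) (point_act R g p)) (g \<otimes> fst ?k, snd ?k)"
    using act_equivariant[OF g hp] by simp
  have "right_act R (left_act R h p) ?k = left_act R h p"
    using right_act_ident[OF left_act_in_points[OF hp]] right_moment_left_act[OF hp] by simp
  moreover have q: "((g \<otimes> fst h, snd h), point_act R g p) \<in> left_pairs L1 R"
    using hp g by (auto simp: left_pairs_bundle bundle1.m_assoc)
  then have "right_act R (left_act R (g \<otimes> fst h, snd h) (point_act R g p))
      (ident L2 (right_moment R (point_act R g p))) = left_act R (g \<otimes> fst h, snd h) (point_act R g p)"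
    using right_act_ident[OF left_act_in_points[OF q]] right_moment_left_act[OF q] by simp
  moreover have "ident L2 (right_moment R (point_act R g p)) = (g \<otimes> fst ?k, snd ?k)"
    using g p by simp
  ultimately show ?thesis using eq by simp
qed

lemma point_act_right_act:
  assumes g: "g \<in> carrier G" and pk: "(p, k) \<in> right_pairs L2 R"
  shows "point_act R g (right_act R p k) = right_act R (point_act R g p) (g \<otimes> fst k, snd k)"
proof -
  have p: "p \<in> points R" using pk by (simp add: right_pairs_bundle)
  let ?h = "ident L1 (left_moment R p)"
  have "(?h, p) \<in> left_pairs L1 R" using p
    by (simp add: left_pairs_iff left_moment_in_objects bundle1.total.ident_in_arrows
        bundle1.total.src_ident
        del: bundle_groupoid_select)
  then have "point_act R g (right_act R (left_act R ?h p) k)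
      = right_act R (left_act R (g \<otimes> fst ?h, snd ?h) (point_act R g p)) (g \<otimes> fst k, snd k)"
    using act_equivariant[OF g _ pk] by simp
  moreover have "ident L1 (left_moment R (point_act R g p)) = (g \<otimes> fst ?h, snd ?h)"
    using g p by simp
  ultimately show ?thesis using left_act_ident[OF p] left_act_ident[of "point_act R g p"] g p by simp
qed

text \<open>Moving the translation by \<open>hol a\<close> past the action of \<open>(1, b)\<close> turns the latter into the
action of \<open>(hol a, b)\<close>, which is composable with \<open>(1, a)\<close> in the bundle groupoid.\<close>

lemma slice_left_act_comp:
  assumes ab: "(a, b) \<in> composable_pairs W1" and bp: "(b, p) \<in> left_pairs W1 S"
  shows "left_act S (arrow_comp W1 a b) p = left_act S a (left_act S b p)"
proof -
  have a: "a \<in> arrows W1" "b \<in> arrows W1" using ab by (simp_all add: bundle1.composable_twisted)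
  have p: "p \<in> points R" using bp by (simp add: left_pairs_slice)
  let ?q = "point_act R (hol1 a \<otimes> hol1 b) p"
  have q: "?q = point_act R (hol1 a) (point_act R (hol1 b) p)"
    using a p by (simp add: point_action.act_mult)
  have c: "((\<one>, a), (hol1 a, b)) \<in> composable_pairs L1"
    using ab a by (intro bundle1.composable_bundleI) auto
  have pair: "((hol1 a, b), ?q) \<in> left_pairs L1 R"
    using bp a by (simp add: left_pairs_slice left_pairs_bundle)
  have "left_act S a (left_act S b p) = left_act R (\<one>, a) (left_act R (hol1 a, b) ?q)"
    using point_act_left_act[OF _ left_pairs_slice_lift[OF bp], of "hol1 a"] a q by simp
  also have "\<dots> = left_act R (arrow_comp L1 (\<one>, a) (hol1 a, b)) ?q"
    by (rule left_act_comp[OF c pair, symmetric])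
  also have "\<dots> = left_act S (arrow_comp W1 a b) p"
    by (simp add: bundle1.holonomy_comp[OF ab])
  finally show ?thesis by simp
qed

lemma slice_right_act_comp:
  assumes pa: "(p, a) \<in> right_pairs W2 S" and ab: "(a, b) \<in> composable_pairs W2"
  shows "right_act S p (arrow_comp W2 a b) = right_act S (right_act S p a) b"
proof -
  have p: "p \<in> points R" using pa by (simp add: right_pairs_slice)
  have c: "((right_coord p, a), (right_coord p \<otimes> hol2 a, b)) \<in> composable_pairs L2"
    using ab p by (intro bundle2.composable_bundleI) auto
  from right_act_comp[OF right_pairs_slice_lift[OF pa] c] show ?thesis
    using slice_right_act(3)[OF pa] by simp
qed

lemma slice_acts_commute:
  assumes ap: "(a, p) \<in> left_pairs W1 S" and pb: "(p, b) \<in> right_pairs W2 S"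
  shows "right_act S (left_act S a p) b = left_act S a (right_act S p b)"
proof -
  have a: "a \<in> arrows W1" "p \<in> points R" "snd (right_moment R p) = rng H2 (snd b)" "b \<in> arrows W2"
    using ap pb by (auto simp: left_pairs_slice right_pairs_slice)
  have k: "(point_act R (hol1 a) p, (hol1 a \<otimes> right_coord p, b)) \<in> right_pairs L2 R"
    using a by (simp add: right_pairs_bundle)
  show ?thesis
    using acts_commute[OF left_pairs_slice_lift[OF ap] k] slice_left_act(3)[OF ap] a
      point_act_right_act[OF _ right_pairs_slice_lift[OF pb], of "hol1 a"] by simp
qed

lemma continuous_point_act:
  "\<lbrakk>continuous_map Z T f; continuous_map Z (point_space R) g\<rbrakk>
    \<Longrightarrow> continuous_map Z (point_space R) (\<lambda>z. point_act R (f z) (g z))"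
  by (rule continuous_map_compose_binary_total[OF point_action.continuous_act])

lemma continuous_left_coord:
  assumes "continuous_map Z (point_space R) f"
  shows "continuous_map Z T (\<lambda>z. left_coord (f z))"
proof -
  have "continuous_map Z (prod_topology T (object_space H1)) (\<lambda>z. left_moment R (f z))"
    using continuous_map_compose_pointwise[OF assms continuous_left_moment] by simp
  then show ?thesis by (rule continuous_map_fst_pointwise)
qed

lemma continuous_right_coord:
  assumes "continuous_map Z (point_space R) f"
  shows "continuous_map Z T (\<lambda>z. right_coord (f z))"
proof -
  have "continuous_map Z (prod_topology T (object_space H2)) (\<lambda>z. right_moment R (f z))"
    using continuous_map_compose_pointwise[OF assms continuous_right_moment] by simp
  then show ?thesis by (rule continuous_map_fst_pointwise)
qed

lemma continuous_one: "continuous_map Z T (\<lambda>z. \<one>)"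
  by (simp add: bundle1.topspace_eq)

lemma bundle_arrow_spaces: "arrow_space L1 = prod_topology T (arrow_space W1)"
  "arrow_space L2 = prod_topology T (arrow_space W2)"
  by (simp_all add: bundle_groupoid_select(1) twisted_groupoid_select(1))

lemma continuous_left_pair_components:
  "continuous_map (left_pair_space W1 S) (arrow_space W1) fst"
  "continuous_map (left_pair_space W1 S) (point_space S) snd"
  "continuous_map (left_pair_space W1 S) (point_space R) snd"
  "continuous_map (left_pair_space L1 R) (arrow_space L1) fst"
  "continuous_map (left_pair_space L1 R) (point_space R) snd"
proof -
  show s: "continuous_map (left_pair_space W1 S) (point_space S) snd"
    unfolding left_pair_space_def by (intro continuous_map_from_subtopology continuous_map_snd)
  show "continuous_map (left_pair_space W1 S) (point_space R) snd"
    using s unfolding identity_slice_select by (rule continuous_map_into_fulltopology)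
qed (unfold left_pair_space_def,
    (intro continuous_map_from_subtopology continuous_map_fst continuous_map_snd)+)

lemma continuous_right_pair_components:
  "continuous_map (right_pair_space W2 S) (arrow_space W2) snd"
  "continuous_map (right_pair_space W2 S) (point_space S) fst"
  "continuous_map (right_pair_space W2 S) (point_space R) fst"
  "continuous_map (right_pair_space L2 R) (arrow_space L2) snd"
  "continuous_map (right_pair_space L2 R) (point_space R) fst"
proof -
  show s: "continuous_map (right_pair_space W2 S) (point_space S) fst"
    unfolding right_pair_space_def by (intro continuous_map_from_subtopology continuous_map_fst)
  show "continuous_map (right_pair_space W2 S) (point_space R) fst"
    using s unfolding identity_slice_select by (rule continuous_map_into_fulltopology)
qed (unfold right_pair_space_def,
    (intro continuous_map_from_subtopology continuous_map_fst continuous_map_snd)+)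

lemma continuous_left_pairs_slice_lift:
  "continuous_map (left_pair_space W1 S) (left_pair_space L1 R)
    (\<lambda>z. ((\<one>, fst z), point_act R (hol1 (fst z)) (snd z)))"
  unfolding left_pair_space_def[of L1 R] bundle_arrow_spaces
proof (rule continuous_map_into_subtopology)
  show "continuous_map (left_pair_space W1 S)
      (prod_topology (prod_topology T (arrow_space W1)) (point_space R))
      (\<lambda>z. ((\<one>, fst z), point_act R (hol1 (fst z)) (snd z)))"
    by (intro continuous_map_pairedI continuous_one continuous_point_act bundle1.continuous_holonomy
        continuous_left_pair_components)
qed (auto simp: left_pair_space_def left_pairs_slice_lift)

lemma continuous_right_pairs_slice_lift:
  "continuous_map (right_pair_space W2 S) (right_pair_space L2 R)
    (\<lambda>z. (fst z, (right_coord (fst z), snd z)))"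
  unfolding right_pair_space_def[of L2 R] bundle_arrow_spaces
proof (rule continuous_map_into_subtopology)
  show "continuous_map (right_pair_space W2 S)
      (prod_topology (point_space R) (prod_topology T (arrow_space W2)))
      (\<lambda>z. (fst z, (right_coord (fst z), snd z)))"
    by (intro continuous_map_pairedI continuous_right_coord continuous_right_pair_components)
qed (auto simp: right_pair_space_def right_pairs_slice_lift)

lemma topspace_slice_pair_spaces: "topspace (left_pair_space W1 S) = left_pairs W1 S"
  "topspace (right_pair_space W2 S) = right_pairs W2 S"
  by (auto simp: left_pair_space_def right_pair_space_def left_pairs_def right_pairs_def)

lemma continuous_slice_left_act:
  "continuous_map (left_pair_space W1 S) (point_space S) (\<lambda>(a, p). left_act S a p)"
proof -
  have "continuous_map (left_pair_space W1 S) (point_space R)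
      (\<lambda>z. left_act R (\<one>, fst z) (point_act R (hol1 (fst z)) (snd z)))"
    using continuous_map_compose_pointwise[OF continuous_left_pairs_slice_lift continuous_left_act]
    by simp
  then have "continuous_map (left_pair_space W1 S) (point_space R) (\<lambda>(a, p). left_act S a p)"
    by (simp add: case_prod_unfold)
  then show ?thesis using slice_left_act(2)
    by (auto simp: continuous_map_in_subtopology topspace_slice_pair_spaces)
qed

lemma continuous_slice_right_act:
  "continuous_map (right_pair_space W2 S) (point_space S) (\<lambda>(p, b). right_act S p b)"
proof -
  have "continuous_map (right_pair_space W2 S) (point_space R)
      (\<lambda>z. right_act R (fst z) (right_coord (fst z), snd z))"
    using continuous_map_compose_pointwise[OF continuous_right_pairs_slice_lift continuous_right_act]
    by simp
  then have "continuous_map (right_pair_space W2 S) (point_space R) (\<lambda>(p, b). right_act S p b)"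
    by (simp add: case_prod_unfold)
  then show ?thesis using slice_right_act(2)
    by (auto simp: continuous_map_in_subtopology topspace_slice_pair_spaces right_pairs_slice)
qed

lemma continuous_slice_projections:
  "continuous_map (prod_topology (point_space S) (point_space S)) (point_space R) fst"
  "continuous_map (prod_topology (point_space S) (point_space S)) (point_space R) snd"
  unfolding identity_slice_select
  by (rule continuous_map_into_fulltopology, rule continuous_map_fst continuous_map_snd)+

text \<open>The pair \<open>(a, p)\<close> is sent to \<open>((1, a), hol a p)\<close>, which embeds the pairs for the slice as
the closed set of those pairs for \<open>R\<close> whose arrow lies over the identity. To compare the targets,
\<open>hol a\<close> must be a function of the points \<open>p' = a \<cdot> p\<close> and \<open>p\<close> alone: it is the quotient of the
\<open>G\<close>-coordinates of their right moments.\<close>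

lemma slice_left_proper:
  "proper_map (left_pair_space W1 S) (prod_topology (point_space S) (point_space S))
    (\<lambda>(a, p). (left_act S a p, p))"
proof (rule proper_map_transfer[OF left_proper])
  let ?lift = "\<lambda>z. ((\<one>, fst z), point_act R (hol1 (fst z)) (snd z))"
  let ?C = "{z \<in> topspace (left_pair_space L1 R). fst (fst z) \<in> {\<one>}}"
  let ?back = "\<lambda>z. (snd (fst z), point_act R (inv (hol1 (snd (fst z)))) (snd z))"
  have arrow: "continuous_map (left_pair_space L1 R) (prod_topology T (arrow_space W1)) fst"
    using continuous_left_pair_components(4) by (simp add: bundle_arrow_spaces)
  show "proper_map (left_pair_space W1 S) (left_pair_space L1 R) ?lift"
  proof (rule proper_map_closed_embedding)
    show "continuous_map (left_pair_space W1 S) (left_pair_space L1 R) ?lift"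
      by (rule continuous_left_pairs_slice_lift)
    show "closedin (left_pair_space L1 R) ?C"
      by (rule closedin_continuous_map_preimage[OF continuous_map_fst_pointwise[OF arrow]])
        (simp add: closedin_Hausdorff_sing_eq bundle1.Hausdorff bundle1.topspace_eq)
    \<comment> \<open>The point in a pair from the image has left moment over \<open>hol a\<close>, which is undone by translation.\<close>
    have "continuous_map (left_pair_space L1 R) (prod_topology (arrow_space W1) (point_space R)) ?back"
      by (intro continuous_map_pairedI continuous_map_snd_pointwise[OF arrow] continuous_point_act
          continuous_map_compose_pointwise[OF _ bundle1.continuous_inv] bundle1.continuous_holonomy
          continuous_left_pair_components)
    then have "continuous_map (subtopology (left_pair_space L1 R) ?C)
        (prod_topology (arrow_space W1) (point_space R)) ?back"
      by (rule continuous_map_from_subtopology)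
    moreover have "?back z \<in> left_pairs W1 S" if "z \<in> ?C" for z
      using that by (cases z) (auto simp: topspace_left_pair_space left_pairs_bundle left_pairs_slice)
    ultimately show "continuous_map (subtopology (left_pair_space L1 R) ?C) (left_pair_space W1 S) ?back"
      unfolding left_pair_space_slice by (intro continuous_map_into_subtopology) auto
    show "?lift z \<in> ?C \<and> ?back (?lift z) = z" if "z \<in> topspace (left_pair_space W1 S)" for z
      using that left_pairs_slice_lift[of "fst z" "snd z"]
      by (cases z) (auto simp: topspace_left_pair_space topspace_slice_pair_spaces left_pairs_slice
          point_act_inverse)
    show "?lift (?back z) = z" if "z \<in> ?C" for z
      using that by (cases z) (auto simp: topspace_left_pair_space left_pairs_bundle point_act_inverse)
  qed
  let ?c = "\<lambda>r. (fst r, point_act R (right_coord (fst r) \<otimes> inv (right_coord (snd r))) (snd r))"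
  show "continuous_map (prod_topology (point_space S) (point_space S))
      (prod_topology (point_space R) (point_space R)) ?c"
    by (intro continuous_map_pairedI continuous_point_act continuous_slice_projections
        continuous_right_coord
        continuous_map_compose_binary_total[OF bundle1.continuous_mult]
        continuous_map_compose_pointwise[OF _ bundle1.continuous_inv])
  show "inj_on ?c (topspace (prod_topology (point_space S) (point_space S)))"
  proof (rule inj_onI)
    fix r r' assume r: "r \<in> topspace (prod_topology (point_space S) (point_space S))"
      "r' \<in> topspace (prod_topology (point_space S) (point_space S))" and eq: "?c r = ?c r'"
    let ?g = "\<lambda>r. right_coord (fst r) \<otimes> inv (right_coord (snd r))"
    have pts: "fst r \<in> points R" "snd r \<in> points R" "left_coord (snd r) = \<one>"
      "fst r' \<in> points R" "snd r' \<in> points R" "left_coord (snd r') = \<one>"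
      using r by auto
    have act: "point_act R (?g r) (snd r) = point_act R (?g r') (snd r')"
      using iffD1[OF prod.inject eq] by (rule conjunct2)
    \<comment> \<open>On the slice, the left moment of \<open>g p\<close> lies over \<open>g\<close>, so \<open>g p\<close> determines \<open>g\<close>.\<close>
    then have "left_coord (point_act R (?g r) (snd r)) = left_coord (point_act R (?g r') (snd r'))"
      by (rule arg_cong)
    then have "?g r = ?g r'" using pts by simp
    then have "snd r = snd r'"
      using act pts point_act_inverse[of "?g r" "snd r"] point_act_inverse[of "?g r'" "snd r'"] by simp
    then show "r = r'" using eq by (simp add: prod_eq_iff)
  qed
  show "(\<lambda>(a, p). (left_act S a p, p)) \<in> topspace (left_pair_space W1 S)
      \<rightarrow> topspace (prod_topology (point_space S) (point_space S))"
    using slice_left_act(1,2)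
    by (auto simp: topspace_slice_pair_spaces left_pairs_slice)
  show "(case ?lift z of (h, q) \<Rightarrow> (left_act R h q, q)) = ?c (case z of (a, p) \<Rightarrow> (left_act S a p, p))"
    if "z \<in> topspace (left_pair_space W1 S)" for z
  proof -
    obtain a p where z: "z = (a, p)" by (cases z)
    have ap: "(a, p) \<in> left_pairs W1 S" using that by (simp add: topspace_slice_pair_spaces z)
    then have closed: "hol1 a \<in> carrier G" "right_coord p \<in> carrier G" by (auto simp: left_pairs_slice)
    have "right_coord (left_act S a p) \<otimes> inv (right_coord p) = hol1 a"
      using closed by (simp add: slice_left_act(3)[OF ap] bundle1.m_assoc del: identity_slice_select)
    then show ?thesis by (simp add: z)
  qed
qed

lemma slice_right_proper:
  "proper_map (right_pair_space W2 S) (prod_topology (point_space S) (point_space S))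
    (\<lambda>(p, b). (p, right_act S p b))"
proof (rule proper_map_transfer[OF right_proper])
  let ?lift = "\<lambda>z. (fst z, (right_coord (fst z), snd z))"
  let ?C = "{z \<in> topspace (right_pair_space L2 R). left_coord (fst z) \<in> {\<one>}}"
  let ?back = "\<lambda>z. (fst z, snd (snd z))"
  have arrow: "continuous_map (right_pair_space L2 R) (prod_topology T (arrow_space W2)) snd"
    using continuous_right_pair_components(4) by (simp add: bundle_arrow_spaces)
  show "proper_map (right_pair_space W2 S) (right_pair_space L2 R) ?lift"
  proof (rule proper_map_closed_embedding)
    show "continuous_map (right_pair_space W2 S) (right_pair_space L2 R) ?lift"
      by (rule continuous_right_pairs_slice_lift)
    show "closedin (right_pair_space L2 R) ?C"
      by (rule closedin_continuous_map_preimage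
          [OF continuous_left_coord[OF continuous_right_pair_components(5)]])
        (simp add: closedin_Hausdorff_sing_eq bundle1.Hausdorff bundle1.topspace_eq)
    have "continuous_map (right_pair_space L2 R) (prod_topology (point_space R) (arrow_space W2)) ?back"
      by (intro continuous_map_pairedI continuous_map_snd_pointwise[OF arrow]
          continuous_right_pair_components)
    then have "continuous_map (subtopology (right_pair_space L2 R) ?C)
        (prod_topology (point_space R) (arrow_space W2)) ?back"
      by (rule continuous_map_from_subtopology)
    moreover have "?back z \<in> right_pairs W2 S" if "z \<in> ?C" for z
      using that by (cases z) (auto simp: topspace_right_pair_space right_pairs_bundle right_pairs_slice)
    ultimately show "continuous_map (subtopology (right_pair_space L2 R) ?C) (right_pair_space W2 S) ?back"
      unfolding right_pair_space_slice by (intro continuous_map_into_subtopology) auto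
    show "?lift z \<in> ?C \<and> ?back (?lift z) = z" if "z \<in> topspace (right_pair_space W2 S)" for z
      using that right_pairs_slice_lift[of "fst z" "snd z"]
      by (cases z) (auto simp: topspace_right_pair_space topspace_slice_pair_spaces right_pairs_slice)
    show "?lift (?back z) = z" if "z \<in> ?C" for z
      using that by (cases z) (auto simp: topspace_right_pair_space right_pairs_bundle)
  qed
  show "continuous_map (prod_topology (point_space S) (point_space S))
      (prod_topology (point_space R) (point_space R)) (\<lambda>r. (fst r, snd r))"
    by (intro continuous_map_pairedI continuous_slice_projections)
  show "(\<lambda>(p, b). (p, right_act S p b)) \<in> topspace (right_pair_space W2 S)
      \<rightarrow> topspace (prod_topology (point_space S) (point_space S))"
    using slice_right_act(1,2)
    by (auto simp: topspace_slice_pair_spaces right_pairs_slice)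
qed (auto simp: inj_on_def)

text \<open>A quotient map restricts to a quotient map over a closed set. The slice is the preimage of
the objects over the identity, and these are closed since \<open>G\<close> is Hausdorff.\<close>

lemma quotient_map_slice_left_moment:
  "quotient_map (point_space S) (object_space W1) (left_moment S)"
proof -
  let ?O = "prod_topology T (object_space H1)"
  let ?V = "{u \<in> topspace ?O. fst u \<in> {\<one>}}"
  have "closedin ?O ?V"
    by (rule closedin_continuous_map_preimage[OF continuous_map_fst])
      (simp add: closedin_Hausdorff_sing_eq bundle1.Hausdorff bundle1.topspace_eq)
  then have restricted: "quotient_map (subtopology (point_space R) {p \<in> points R. left_moment R p \<in> ?V})
      (subtopology ?O ?V) (left_moment R)"
    using quotient_map_restriction[OF quotient_map_left_moment, of ?V] by simp
  have "{p \<in> points R. left_moment R p \<in> ?V} = points R \<inter> {p. left_coord p = \<one>}"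
    using left_moment_in_objects by auto
  from restricted[unfolded this subtopology_restrict]
  have "quotient_map (point_space S) (subtopology ?O ?V) (left_moment R)" by simp
  moreover have "quotient_map (subtopology ?O ?V) (object_space H1) snd"
  proof (rule quotient_map_from_composition)
    show "continuous_map (object_space H1) (subtopology ?O ?V) (\<lambda>u. (\<one>, u))"
      by (intro continuous_map_into_subtopology continuous_map_pairedI continuous_one
          continuous_map_identity) (auto simp: bundle1.topspace_eq)
    show "continuous_map (subtopology ?O ?V) (object_space H1) snd"
      by (intro continuous_map_from_subtopology continuous_map_snd)
    show "quotient_map (object_space H1) (object_space H1) (snd \<circ> (\<lambda>u. (\<one>, u)))"
      by (simp add: o_def quotient_map_def Collect_conj_eq Int_absorb1 openin_subset flip: Int_def)
  qed
  ultimately have "quotient_map (point_space S) (object_space H1) (snd \<circ> left_moment R)"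
    by (rule quotient_map_compose)
  then show ?thesis by (simp add: o_def)
qed

text \<open>Translating each point into the slice is a continuous map from \<open>R\<close> that changes only the
\<open>G\<close>-coordinate of the right moment. So the composite of the right moment on \<open>R\<close> with the
projection to the objects of \<open>H2\<close>, which is a quotient map, factors through the slice.\<close>

lemma quotient_map_slice_right_moment:
  "quotient_map (point_space S) (object_space W2) (right_moment S)"
proof (rule quotient_map_from_composition)
  let ?r = "\<lambda>p. point_act R (inv (left_coord p)) p"
  have "continuous_map (point_space R) (point_space R) ?r"
    by (intro continuous_point_act continuous_left_coord continuous_map_identity
        continuous_map_compose_pointwise[OF _ bundle1.continuous_inv])
  then show "continuous_map (point_space R) (point_space S) ?r"
    by (auto simp: continuous_map_in_subtopology)
  have "continuous_map (point_space S) (prod_topology T (object_space H2)) (right_moment R)"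
    using continuous_right_moment by (simp add: continuous_map_from_subtopology)
  then show "continuous_map (point_space S) (object_space W2) (right_moment S)"
    by (simp add: continuous_map_snd_pointwise)
  have "T \<noteq> trivial_topology" using bundle1.topspace_eq bundle1.one_closed by force
  then have "quotient_map (prod_topology T (object_space H2)) (object_space H2) snd" by simp
  moreover have "quotient_map (point_space R) (prod_topology T (object_space H2)) (right_moment R)"
    using quotient_map_right_moment by simp
  ultimately have "quotient_map (point_space R) (object_space H2) (snd \<circ> right_moment R)"
    by (rule quotient_map_compose[rotated])
  then show "quotient_map (point_space R) (object_space W2) (right_moment S \<circ> ?r)"
    unfolding twisted_groupoid_select by (rule quotient_map_eq) simp
qed

lemma slice_left_moment_homeomorphic:
  "homeomorphic_map (quotient_space (point_space S) (right_orbits W2 S)) (object_space W1)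
    (\<lambda>c. the_elem (left_moment S ` c))"
  unfolding right_orbits_def
proof (rule homeomorphic_map_orbit_spaceI)
  show "quotient_map (point_space S) (object_space W1) (left_moment S)"
    by (rule quotient_map_slice_left_moment)
  show "(p, q) \<in> {(p, right_act S p b) |p b. (p, b) \<in> right_pairs W2 S} \<longleftrightarrow>
    p \<in> points S \<and> q \<in> points S \<and> left_moment S p = left_moment S q" for p q
  proof
    assume "p \<in> points S \<and> q \<in> points S \<and> left_moment S p = left_moment S q"
    then have pq: "p \<in> points R" "q \<in> points R" "left_coord p = \<one>" "left_coord q = \<one>"
      "left_moment R p = left_moment R q"
      unfolding points_slice by (simp_all add: prod_eq_iff)
    then obtain k where k: "(p, k) \<in> right_pairs L2 R" "right_act R p k = q"
      using left_moment_eqD by blast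
    then have "(p, snd k) \<in> right_pairs W2 S" "right_act S p (snd k) = q"
      using pq by (auto simp: right_pairs_bundle right_pairs_slice)
    then show "(p, q) \<in> {(p, right_act S p b) |p b. (p, b) \<in> right_pairs W2 S}" by blast
  next
    assume "(p, q) \<in> {(p, right_act S p b) |p b. (p, b) \<in> right_pairs W2 S}"
    then obtain b where "(p, b) \<in> right_pairs W2 S" "q = right_act S p b" by blast
    then show "p \<in> points S \<and> q \<in> points S \<and> left_moment S p = left_moment S q"
      using slice_right_act(1,2)[of p b] unfolding points_slice by (auto simp: right_pairs_slice)
  qed
qed

text \<open>If \<open>p\<close> and \<open>q\<close> in the slice have right moments that differ in the \<open>G\<close>-coordinate only, then
a translate \<open>g p\<close> has the same right moment as \<open>q\<close>, so \<open>q = h (g p)\<close> for an arrow \<open>h\<close>. Comparing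
left moments, \<open>h\<close> lies over the identity and has holonomy \<open>g\<close>, which says that \<open>q\<close> is in the orbit
of \<open>p\<close> in the slice.\<close>

lemma slice_right_moment_homeomorphic:
  "homeomorphic_map (quotient_space (point_space S) (left_orbits W1 S)) (object_space W2)
    (\<lambda>c. the_elem (right_moment S ` c))"
  unfolding left_orbits_def
proof (rule homeomorphic_map_orbit_spaceI)
  show "quotient_map (point_space S) (object_space W2) (right_moment S)"
    by (rule quotient_map_slice_right_moment)
  show "(p, q) \<in> {(p, left_act S a p) |a p. (a, p) \<in> left_pairs W1 S} \<longleftrightarrow>
    p \<in> points S \<and> q \<in> points S \<and> right_moment S p = right_moment S q" for p q
  proof
    assume "p \<in> points S \<and> q \<in> points S \<and> right_moment S p = right_moment S q"
    then have pq: "p \<in> points R" "q \<in> points R" "left_coord p = \<one>" "left_coord q = \<one>"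
      "snd (right_moment R p) = snd (right_moment R q)"
      unfolding points_slice by simp_all
    define g where "g = right_coord q \<otimes> inv (right_coord p)"
    have g: "g \<in> carrier G" "g \<otimes> right_coord p = right_coord q"
      using pq by (simp_all add: g_def bundle1.m_assoc)
    then have "right_moment R (point_act R g p) = right_moment R q" using pq by (simp add: prod_eq_iff)
    then obtain h where h: "(h, point_act R g p) \<in> left_pairs L1 R"
      "left_act R h (point_act R g p) = q"
      using right_moment_eqD[of "point_act R g p" q] pq g by auto
    have "fst h = \<one>" using left_moment_left_act[OF h(1)] h(2) pq by simp
    moreover from this have "hol1 (snd h) = g" "snd h \<in> arrows W1"
      "snd (left_moment R p) = src H1 (snd (snd h))"
      using h(1) g pq by (auto simp: left_pairs_bundle)
    ultimately have "(snd h, p) \<in> left_pairs W1 S" "left_act S (snd h) p = q"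
      using h(2) pq by (auto simp: left_pairs_slice prod_eq_iff) (metis prod.collapse)
    then show "(p, q) \<in> {(p, left_act S a p) |a p. (a, p) \<in> left_pairs W1 S}" by blast
  next
    assume "(p, q) \<in> {(p, left_act S a p) |a p. (a, p) \<in> left_pairs W1 S}"
    then obtain a where "(a, p) \<in> left_pairs W1 S" "q = left_act S a p" by blast
    then show "p \<in> points S \<and> q \<in> points S \<and> right_moment S p = right_moment S q"
      using slice_left_act[of a p] unfolding points_slice by (auto simp: left_pairs_slice)
  qed
qed

theorem morita_bimodule_slice: "morita_bimodule W1 W2 S"
proof -
  interpret W1: topological_groupoid W1 by (rule bundle1.topological_groupoid_twisted)
  interpret W2: topological_groupoid W2 by (rule bundle2.topological_groupoid_twisted)
  \<comment> \<open>The two ends of the unit \<open>(1, e)\<close> have \<open>G\<close>-coordinates \<open>1\<close> and \<open>hol e\<close>, so \<open>hol e = 1\<close>.\<close>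
  have ident: "left_act R (\<one>, ident W1 (snd (left_moment R p)))
      (point_act R (hol1 (ident W1 (snd (left_moment R p)))) p) = p" if "p \<in> points S" for p
  proof -
    have p: "p \<in> points R" "left_moment R p = (\<one>, snd (left_moment R p))"
      using that by (auto simp: prod_eq_iff)
    let ?e = "ident L1 (left_moment R p)"
    have e: "?e = (\<one>, ident W1 (snd (left_moment R p)))" using p(2) by (simp add: prod_eq_iff)
    have "?e \<in> arrows L1" "src L1 ?e = left_moment R p"
      using left_moment_in_objects[OF p(1)]
      by (simp_all add: bundle1.total.ident_in_arrows bundle1.total.src_ident del: bundle_groupoid_select)
    then have "\<one> \<otimes> hol1 (ident W1 (snd (left_moment R p))) = \<one>"
      "hol1 (ident W1 (snd (left_moment R p))) \<in> carrier G"
      using p(2) by (auto simp: bundle1.src_bundle e bundle1.arrows_bundle prod_eq_iff)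
    then show ?thesis using left_act_ident[OF p(1)] e p(1) by (simp add: point_action.act_one)
  qed
  show ?thesis
  proof
    show "continuous_map (point_space S) (object_space W1) (left_moment S)"
      by (rule quotient_imp_continuous_map[OF quotient_map_slice_left_moment])
    show "continuous_map (point_space S) (object_space W2) (right_moment S)"
      by (rule quotient_imp_continuous_map[OF quotient_map_slice_right_moment])
    show "continuous_map (left_pair_space W1 S) (point_space S) (\<lambda>(a, p). left_act S a p)"
      by (rule continuous_slice_left_act)
    show "continuous_map (right_pair_space W2 S) (point_space S) (\<lambda>(p, b). right_act S p b)"
      by (rule continuous_slice_right_act)
  next
    fix p assume "p \<in> points S"
    then show "left_act S (ident W1 (left_moment S p)) p = p" by (simp add: ident)
    show "right_act S p (ident W2 (right_moment S p)) = p"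
      using right_act_ident[of p] \<open>p \<in> points S\<close> by simp
  next
    fix a p assume ap: "(a, p) \<in> left_pairs W1 S" and eq: "left_act S a p = p"
    have p: "a \<in> arrows W1" "p \<in> points R" "left_moment R p = (\<one>, src H1 (snd a))"
      using ap by (auto simp: left_pairs_slice)
    \<comment> \<open>The right moment is invariant under \<open>L1\<close>, so it detects the translation by \<open>hol a\<close>.\<close>
    have "hol1 a \<otimes> right_coord p = right_coord p"
      using slice_left_act(3)[OF ap] unfolding eq by (metis fst_conv)
    then have "hol1 a = \<one>" using p bundle1.r_cancel_one by simp
    then have "((\<one>, a), p) \<in> left_pairs L1 R" "left_act R (\<one>, a) p = p"
      using left_pairs_slice_lift[OF ap] eq p by (simp_all add: point_action.act_one)
    from left_free[OF this] show "a = ident W1 (left_moment S p)" by simp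
  next
    fix p b assume pb: "(p, b) \<in> right_pairs W2 S" and eq: "right_act S p b = p"
    from right_free[OF right_pairs_slice_lift[OF pb]] eq
    show "b = ident W2 (right_moment S p)" by simp
  qed (rule slice_left_proper slice_right_proper slice_left_moment_homeomorphic
      slice_right_moment_homeomorphic slice_left_act_comp slice_right_act_comp slice_acts_commute
    | assumption
    | simp only: slice_left_act slice_right_act identity_slice_select(2,3) twisted_groupoid_select
      snd_conv)+
qed

text \<open>The map \<open>p \<mapsto> (g, p)\<close> from the slice to \<open>G \<times> R\<close>, where \<open>g\<close> is the \<open>G\<close>-coordinate of the right
moment of \<open>p\<close>, is equivariant along \<open>\<iota>\<close> on both sides.\<close>

lemma dual_inclusion_left_pairs:
  assumes "(a, p) \<in> left_pairs W1 S"
  shows "(dual_inclusion G \<rho>1 a, (right_coord p, p))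
      \<in> left_pairs (crossed_groupoid G T L1) (crossed_bimodule G T L2 R)"
    and "left_act (crossed_bimodule G T L2 R) (dual_inclusion G \<rho>1 a) (right_coord p, p)
      = (right_coord (left_act S a p), left_act S a p)"
proof -
  have a: "a \<in> arrows W1" "p \<in> points R" "left_moment R p = (\<one>, src H1 (snd a))"
    using assms by (auto simp: left_pairs_slice)
  then show "(dual_inclusion G \<rho>1 a, (right_coord p, p))
      \<in> left_pairs (crossed_groupoid G T L1) (crossed_bimodule G T L2 R)"
    by (simp add: left_pairs_def bundle1.dual_inclusion_eq bundle1.topspace_eq bundle1.arrows_bundle
        bundle1.src_bundle)
  show "left_act (crossed_bimodule G T L2 R) (dual_inclusion G \<rho>1 a) (right_coord p, p)
      = (right_coord (left_act S a p), left_act S a p)"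
    using slice_left_act(3)[OF assms] by (simp add: bundle1.dual_inclusion_eq)
qed

lemma dual_inclusion_right_pairs:
  assumes "(p, b) \<in> right_pairs W2 S"
  shows "((right_coord p, p), dual_inclusion G \<rho>2 b)
      \<in> right_pairs (crossed_groupoid G T L2) (crossed_bimodule G T L2 R)"
    and "right_act (crossed_bimodule G T L2 R) (right_coord p, p) (dual_inclusion G \<rho>2 b)
      = (right_coord (right_act S p b), right_act S p b)"
proof -
  have b: "b \<in> arrows W2" "p \<in> points R" "snd (right_moment R p) = rng H2 (snd b)"
    using assms by (auto simp: right_pairs_slice)
  then show "((right_coord p, p), dual_inclusion G \<rho>2 b)
      \<in> right_pairs (crossed_groupoid G T L2) (crossed_bimodule G T L2 R)"
    by (simp add: right_pairs_def bundle2.dual_inclusion_eq bundle1.topspace_eq bundle2.arrows_bundle)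
  show "right_act (crossed_bimodule G T L2 R) (right_coord p, p) (dual_inclusion G \<rho>2 b)
      = (right_coord (right_act S p b), right_act S p b)"
    using slice_right_act(3)[OF assms] b by (simp add: bundle2.dual_inclusion_eq)
qed

lemma cohomologous_along_slice:
  assumes "cohomologous_along (crossed_groupoid G T L1) (crossed_groupoid G T L2)
    (crossed_bimodule G T L2 R) \<psi>1 \<psi>2"
  shows "cohomologous_along W1 W2 S (dual_cocycle G \<rho>1 \<psi>1) (dual_cocycle G \<rho>2 \<psi>2)"
proof -
  let ?C1 = "crossed_groupoid G T L1" and ?C2 = "crossed_groupoid G T L2"
  let ?X = "crossed_bimodule G T L2 R"
  let ?i1 = "dual_inclusion G \<rho>1" and ?i2 = "dual_inclusion G \<rho>2"
  obtain \<mu> \<nu> where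
    \<mu>: "continuous_map (left_pair_space ?C1 ?X) circle_space (\<lambda>(h, p). \<mu> h p)" and
    \<nu>: "continuous_map (right_pair_space ?C2 ?X) circle_space (\<lambda>(p, k). \<nu> p k)" and
    \<mu>_eq: "\<And>h h' p. (h, h') \<in> composable_pairs ?C1 \<Longrightarrow> (h', p) \<in> left_pairs ?C1 ?X \<Longrightarrow>
      \<mu> h' p * inverse (\<mu> (arrow_comp ?C1 h h') p) * \<mu> h (left_act ?X h' p) = \<psi>1 h h'" and
    \<nu>_eq: "\<And>p k k'. (p, k) \<in> right_pairs ?C2 ?X \<Longrightarrow> (k, k') \<in> composable_pairs ?C2 \<Longrightarrow>
      \<nu> (right_act ?X p k) k' * inverse (\<nu> p (arrow_comp ?C2 k k')) * \<nu> p k = \<psi>2 k k'" and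
    \<mu>\<nu>: "\<And>h p k. (h, p) \<in> left_pairs ?C1 ?X \<Longrightarrow> (p, k) \<in> right_pairs ?C2 ?X \<Longrightarrow>
      \<mu> h p * \<nu> (left_act ?X h p) k = \<nu> p k * \<mu> h (right_act ?X p k)"
    using assms unfolding cohomologous_along_def by blast
  define \<mu>' where "\<mu>' a p = \<mu> (?i1 a) (right_coord p, p)" for a p
  define \<nu>' where "\<nu>' p b = \<nu> (right_coord p, p) (?i2 b)" for p b
  have "continuous_map (left_pair_space W1 S) circle_space (\<lambda>z. \<mu>' (fst z) (snd z))"
    unfolding \<mu>'_def
  proof (rule continuous_map_compose_binary[OF \<mu>[unfolded left_pair_space_def]])
    show "continuous_map (left_pair_space W1 S) (arrow_space ?C1) (\<lambda>z. ?i1 (fst z))"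
      unfolding crossed_groupoid_select bundle_arrow_spaces bundle1.dual_inclusion_eq
      by (intro continuous_map_pairedI continuous_one bundle1.continuous_holonomy
          continuous_left_pair_components)
    show "continuous_map (left_pair_space W1 S) (point_space ?X)
        (\<lambda>z. (right_coord (snd z), snd z))"
      unfolding crossed_bimodule_select
      by (intro continuous_map_pairedI continuous_right_coord continuous_left_pair_components)
  qed (simp add: topspace_slice_pair_spaces dual_inclusion_left_pairs(1))
  moreover have "continuous_map (right_pair_space W2 S) circle_space (\<lambda>z. \<nu>' (fst z) (snd z))"
    unfolding \<nu>'_def
  proof (rule continuous_map_compose_binary[OF \<nu>[unfolded right_pair_space_def]])
    show "continuous_map (right_pair_space W2 S) (arrow_space ?C2) (\<lambda>z. ?i2 (snd z))"
      unfolding crossed_groupoid_select bundle_arrow_spaces bundle2.dual_inclusion_eq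
      by (intro continuous_map_pairedI continuous_one bundle2.continuous_holonomy
          continuous_right_pair_components)
    show "continuous_map (right_pair_space W2 S) (point_space ?X)
        (\<lambda>z. (right_coord (fst z), fst z))"
      unfolding crossed_bimodule_select
      by (intro continuous_map_pairedI continuous_right_coord continuous_right_pair_components)
  qed (simp add: topspace_slice_pair_spaces dual_inclusion_right_pairs(1))
  moreover have "\<mu>' b p * inverse (\<mu>' (arrow_comp W1 a b) p) * \<mu>' a (left_act S b p)
      = dual_cocycle G \<rho>1 \<psi>1 a b"
    if "(a, b) \<in> composable_pairs W1" "(b, p) \<in> left_pairs W1 S" for a b p
    using \<mu>_eq[OF bundle1.dual_inclusion_composable[OF that(1)] dual_inclusion_left_pairs(1)[OF that(2)]]
    by (simp only: \<mu>'_def dual_cocycle_def bundle1.dual_inclusion_comp[OF that(1)]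
        dual_inclusion_left_pairs(2)[OF that(2)])
  moreover have "\<nu>' (right_act S p a) b * inverse (\<nu>' p (arrow_comp W2 a b)) * \<nu>' p a
      = dual_cocycle G \<rho>2 \<psi>2 a b"
    if "(p, a) \<in> right_pairs W2 S" "(a, b) \<in> composable_pairs W2" for a b p
    using \<nu>_eq[OF dual_inclusion_right_pairs(1)[OF that(1)] bundle2.dual_inclusion_composable[OF that(2)]]
    by (simp only: \<nu>'_def dual_cocycle_def bundle2.dual_inclusion_comp[OF that(2)]
        dual_inclusion_right_pairs(2)[OF that(1)])
  moreover have "\<mu>' a p * \<nu>' (left_act S a p) b = \<nu>' p b * \<mu>' a (right_act S p b)"
    if "(a, p) \<in> left_pairs W1 S" "(p, b) \<in> right_pairs W2 S" for a b p
    using \<mu>\<nu>[OF dual_inclusion_left_pairs(1)[OF that(1)] dual_inclusion_right_pairs(1)[OF that(2)]]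
    by (simp only: \<mu>'_def \<nu>'_def dual_inclusion_left_pairs(2)[OF that(1)]
        dual_inclusion_right_pairs(2)[OF that(2)])
  ultimately show ?thesis
    unfolding cohomologous_along_def case_prod_unfold by blast
qed

end


section \<open>Duals of equivalent data\<close>

theorem corollary15p2:
  fixes G :: "('g, 'm) monoid_scheme" and T :: "'g topology" and N :: "'g set"
    and H1 :: "('a, 'u) groupoid" and m1 :: "'u \<Rightarrow> 'a measure"
    and H2 :: "('b, 'v) groupoid" and m2 :: "'v \<Rightarrow> 'b measure"
    and \<rho>1' :: "'a \<Rightarrow> 'g set" and \<rho>1 :: "'a \<Rightarrow> 'g"
    and \<rho>2' :: "'b \<Rightarrow> 'g set" and \<rho>2 :: "'b \<Rightarrow> 'g"
    and \<sigma>1 :: "'g \<times> 'g \<times> 'a \<Rightarrow> 'g \<times> 'g \<times> 'a \<Rightarrow> complex"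
    and lam1 :: "'g \<Rightarrow> 'g \<times> 'g \<times> 'a \<Rightarrow> complex" and \<beta>1 :: "'g \<Rightarrow> 'g \<Rightarrow> 'g \<times> 'u \<Rightarrow> complex"
    and \<sigma>2 :: "'g \<times> 'g \<times> 'b \<Rightarrow> 'g \<times> 'g \<times> 'b \<Rightarrow> complex"
    and lam2 :: "'g \<Rightarrow> 'g \<times> 'g \<times> 'b \<Rightarrow> complex" and \<beta>2 :: "'g \<Rightarrow> 'g \<Rightarrow> 'g \<times> 'v \<Rightarrow> complex"
    and R :: "('g, 'p, 'g \<times> 'g \<times> 'a, 'g \<times> 'g \<times> 'b, 'g \<times> 'u, 'g \<times> 'v) G_bimodule"
  assumes "locally_compact_group G T" and "N \<lhd> G" and "closedin T N"
    and "left_haar_groupoid H1 m1" and "left_haar_groupoid H2 m2"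
    and "homomorphism_to_quotient G T N H1 \<rho>1'" and "continuous_lift G T N H1 \<rho>1' \<rho>1"
    and "homomorphism_to_quotient G T N H2 \<rho>2'" and "continuous_lift G T N H2 \<rho>2' \<rho>2"
    and "equivariant_2cocycle G T (bundle_groupoid G T N H1 \<rho>1) \<sigma>1 lam1 \<beta>1"
    and "equivariant_2cocycle G T (bundle_groupoid G T N H2 \<rho>2) \<sigma>2 lam2 \<beta>2"
    and "equivariant_morita_bimodule G T
      (bundle_groupoid G T N H1 \<rho>1) (bundle_groupoid G T N H2 \<rho>2) R"
    and "cohomologous_along
      (crossed_groupoid G T (bundle_groupoid G T N H1 \<rho>1))
      (crossed_groupoid G T (bundle_groupoid G T N H2 \<rho>2))
      (crossed_bimodule G T (bundle_groupoid G T N H2 \<rho>2) R)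
      (crossed_cocycle (bundle_groupoid G T N H1 \<rho>1) \<sigma>1 lam1 \<beta>1)
      (crossed_cocycle (bundle_groupoid G T N H2 \<rho>2) \<sigma>2 lam2 \<beta>2)"
  shows "\<exists>P :: (complex \<times> 'p, complex \<times> 'g \<times> 'a, complex \<times> 'g \<times> 'b, 'u, 'v) bimodule.
    morita_bimodule
      (gerbe_groupoid (twisted_groupoid G T N H1 \<rho>1)
        (dual_cocycle G \<rho>1 (crossed_cocycle (bundle_groupoid G T N H1 \<rho>1) \<sigma>1 lam1 \<beta>1)))
      (gerbe_groupoid (twisted_groupoid G T N H2 \<rho>2)
        (dual_cocycle G \<rho>2 (crossed_cocycle (bundle_groupoid G T N H2 \<rho>2) \<sigma>2 lam2 \<beta>2)))
      P"
proof -
  interpret normal N G by fact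
  have N: "N \<subseteq> carrier G" by (rule subset)
  interpret R: equivariant_morita_bimodule G T "bundle_groupoid G T N H1 \<rho>1"
    "bundle_groupoid G T N H2 \<rho>2" R by fact
  interpret equivariant_bundle_bimodule G T N H1 \<rho>1 H2 \<rho>2 R
  proof (intro equivariant_bundle_bimodule.intro principal_bundle.intro principal_bundle_axioms.intro)
    show "continuous_map (arrow_space H1) T \<rho>1" "continuous_map (arrow_space H2) T \<rho>2"
      using assms unfolding continuous_lift_def by blast+
  qed (fact N assms R.left.topological_groupoid_axioms R.right.topological_groupoid_axioms)+
  show ?thesis
    by (rule cohomologous_along_imp_morita_gerbes[OF morita_bimodule_slice
          cohomologous_along_slice bundle1.continuous_dual_cocycle bundle2.continuous_dual_cocycle])
      (fact assms)+
qed

end
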